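(* Let $U_0^{(1)}$ and $U_0^{(2)}$ be admissible initial conditions, and let $(U^{(1)}(t,x),L^{(1)}_t)$ and $(U^{(2)}(t,x),L^{(2)}_t)$ denote the classical solutions of the free boundary problem (FBP) with initial conditions $U_0^{(1)}$ and $U_0^{(2)}$ respectively. If $L^{(1)}_t=L^{(2)}_t$ for all $t>0$, then $U_0^{(1)}=U_0^{(2)}$.
   Context: Admissible initial condition: a càdlàg non-increasing function $U_0:\mathbb R\to[0,1]$ with $U_0(x)\to 1$ as $x\to-\infty$ and $U_0(x)\to 0$ as $x\to\infty$. (FBP): $\partial_t U=\frac12\Delta U+U$ for $t>0$, $x>L_t$; $U(t,x)=1$ for $t>0$, $x\le L_t$; $\partial_xU(t,L_t)=0$ for $t>0$; $U(t,\cdot)\to U_0(\cdot)$ in $L^1_{\mathrm{loc}}$ as $t\to0$. A classical solution is a pair $(U(t,x),L_t)$ such that: (i) $L_t\in\mathbb R$ for all $t>0$ and $t\mapsto L_t$ is continuous on $(0,\infty)$; (ii) $U:(0,\infty)\times\mathbb R\to[0,1]$ with $U\in C^{1,2}(\{(t,x):t>0,x>L_t\})\cap C((0,\infty)\times\mathbb R)$; (iii) $(U,L)$ satisfies (FBP). For every admissible $U_0$ a classical solution exists and is unique (known). *)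

theory Defs
  imports "HOL-Analysis.Analysis"
begin

definition cadlag :: "(real \<Rightarrow> real) \<Rightarrow> bool" where
  "cadlag f \<longleftrightarrow>
     (\<forall>x. continuous (at_right x) f \<and> (\<exists>l. (f \<longlongrightarrow> l) (at_left x)))"

definition admissible :: "(real \<Rightarrow> real) \<Rightarrow> bool" where
  "admissible U0 \<longleftrightarrow>
     range U0 \<subseteq> {0..1} \<and> cadlag U0 \<and> antimono U0 \<and>
     (U0 \<longlongrightarrow> 1) at_bot \<and> (U0 \<longlongrightarrow> 0) at_top"

text \<open>Convergence in \<open>L\<^sup>1\<close> on every compact set. Integrability is required explicitly
  because the Bochner integral of a non-integrable function is \<open>0\<close>.\<close>

definition L1_loc_tendsto ::
  "('i \<Rightarrow> real \<Rightarrow> real) \<Rightarrow> (real \<Rightarrow> real) \<Rightarrow> 'i filter \<Rightarrow> bool" where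
  "L1_loc_tendsto f g F \<longleftrightarrow>
     (\<forall>K. compact K \<longrightarrow>
        (\<forall>\<^sub>F i in F. set_integrable lborel K (\<lambda>x. f i x - g x)) \<and>
        ((\<lambda>i. LINT x:K|lborel. \<bar>f i x - g x\<bar>) \<longlongrightarrow> 0) F)"

definition deriv_t :: "(real \<Rightarrow> real \<Rightarrow> real) \<Rightarrow> real \<Rightarrow> real \<Rightarrow> real" where
  "deriv_t U t x = deriv (\<lambda>s. U s x) t"

definition deriv_x :: "(real \<Rightarrow> real \<Rightarrow> real) \<Rightarrow> real \<Rightarrow> real \<Rightarrow> real" where
  "deriv_x U t x = deriv (\<lambda>y. U t y) x"

text \<open>The parabolic class \<open>C\<close> with exponents \<open>1,2\<close> on an open set \<open>S\<close> of points \<open>(t, x)\<close>: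
  the derivatives of order at most one in \<open>t\<close> and at most two in \<open>x\<close> (no mixed ones)
  exist and are continuous on \<open>S\<close>.\<close>

definition C12_on :: "(real \<times> real) set \<Rightarrow> (real \<Rightarrow> real \<Rightarrow> real) \<Rightarrow> bool" where
  "C12_on S U \<longleftrightarrow>
     (\<forall>(t, x) \<in> S.
        (\<lambda>s. U s x) field_differentiable (at t) \<and>
        (\<lambda>y. U t y) field_differentiable (at x) \<and>
        (\<lambda>y. deriv_x U t y) field_differentiable (at x)) \<and>
     continuous_on S (\<lambda>(t, x). U t x) \<and>
     continuous_on S (\<lambda>(t, x). deriv_t U t x) \<and>
     continuous_on S (\<lambda>(t, x). deriv_x U t x) \<and>
     continuous_on S (\<lambda>(t, x). deriv_x (deriv_x U) t x)"

text \<open>Only the values \<open>U t x\<close> and \<open>L t\<close> for \<open>t > 0\<close> matter. The boundary condition on the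
  space derivative is the two-sided derivative of \<open>U t\<close> at \<open>L t\<close>; its left half is automatic
  since \<open>U t\<close> is constant on \<open>{..L t}\<close>.\<close>

definition FBP ::
  "(real \<Rightarrow> real) \<Rightarrow> (real \<Rightarrow> real \<Rightarrow> real) \<Rightarrow> (real \<Rightarrow> real) \<Rightarrow> bool" where
  "FBP U0 U L \<longleftrightarrow>
     (\<forall>t>0. \<forall>x>L t. deriv_t U t x = 1/2 * deriv_x (deriv_x U) t x + U t x) \<and>
     (\<forall>t>0. \<forall>x\<le>L t. U t x = 1) \<and>
     (\<forall>t>0. ((\<lambda>x. U t x) has_real_derivative 0) (at (L t))) \<and>
     L1_loc_tendsto U U0 (at_right 0)"

definition classical_solution ::
  "(real \<Rightarrow> real) \<Rightarrow> (real \<Rightarrow> real \<Rightarrow> real) \<Rightarrow> (real \<Rightarrow> real) \<Rightarrow> bool" where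
  "classical_solution U0 U L \<longleftrightarrow>
     continuous_on {0<..} L \<and>
     (\<forall>t>0. \<forall>x. U t x \<in> {0..1}) \<and>
     C12_on {(t, x). t > 0 \<and> x > L t} U \<and>
     continuous_on ({0<..} \<times> UNIV) (\<lambda>(t, x). U t x) \<and>
     FBP U0 U L"

end

theory Submission
  imports Defs "HOL-Probability.Distributions" "HOL-Complex_Analysis.Great_Picard"
begin

text \<open>The difference \<open>w = exp (- t) * (U1 - U2)\<close> solves the heat equation to the right of the common
  free boundary, vanishes to its left, and has zero slope on it. A contact-point argument shows that
  \<open>w\<close> obeys the comparison principle across the boundary, so that \<open>w\<close> is the Gaussian evolution of
  \<open>w s\<close> on the whole line for every \<open>s > 0\<close>. Hence \<open>w t\<close> is the restriction of an entire
  function; as it vanishes on a half-line it is zero, and letting \<open>t\<close> tend to zero identifies the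
  initial conditions.\<close>

subsection \<open>Comparison across the free boundary\<close>

text \<open>The obstacle is the lack of regularity on the free boundary. \<open>L\<close> is merely
  continuous, and on its graph \<open>w\<close> is only known to be continuous with zero slope in
  space; a time derivative or a second space derivative need not exist there, so the usual test at a
  minimum breaks down exactly on that curve. All regularity is therefore placed on the competitor
  \<open>h\<close>, which is smooth across the boundary and a supersolution with a uniform margin
  \<open>\<kappa>\<close>. The same margin keeps Hopf's lemma elementary: no strong maximum
  principle is involved. The evolution starts at a positive time because the data at time zero are
  attained only in the local mean, whereas \<open>w s\<close> is continuous and bounded. The
  Gaussian evolution of \<open>w s\<close> is reached only as a limit: \<open>w s\<close> is cut off
  and slightly smoothed, the comparison gives an explicit error, and a normal-family argument
  carries analyticity to the limit.\<close>

lemma left_min_imp_deriv_nonpos: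
  fixes f :: "real \<Rightarrow> real"
  assumes "(f has_real_derivative D) (at t)" and "d > 0"
    and "\<And>s. t - d < s \<Longrightarrow> s < t \<Longrightarrow> f t \<le> f s"
  shows "D \<le> 0"
proof (rule ccontr)
  assume "\<not> D \<le> 0"
  then obtain e where e: "e > 0" "\<And>h. 0 < h \<Longrightarrow> h < e \<Longrightarrow> f (t - h) < f t"
    using DERIV_pos_inc_left[OF assms(1)] by force
  define h where "h = min d e / 2"
  have "0 < h" "h < e" "h < d" using e assms(2) by (auto simp: h_def)
  then show False using e(2)[of h] assms(3)[of "t - h"] by force
qed

text \<open>Only the left side of \<open>x\<close> is inspected, since at a contact point the
  barrier is known to be minimal only where \<open>w\<close> vanishes. A negative \<open>D\<close>
  would make \<open>f'\<close> positive just left of \<open>x\<close>, so \<open>f\<close> would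
  increase strictly up to \<open>x\<close>.\<close>

lemma left_min_imp_second_deriv_nonneg:
  fixes f f' :: "real \<Rightarrow> real"
  assumes "d > 0"
    and der: "\<And>y. x - d < y \<Longrightarrow> y \<le> x \<Longrightarrow> (f has_real_derivative f' y) (at y)"
    and "f' x = 0" and der2: "(f' has_real_derivative D) (at x)"
    and le: "\<And>y. x - d < y \<Longrightarrow> y < x \<Longrightarrow> f x \<le> f y"
  shows "D \<ge> 0"
proof (rule ccontr)
  assume "\<not> D \<ge> 0"
  then obtain e where e: "e > 0" "\<And>h. 0 < h \<Longrightarrow> h < e \<Longrightarrow> f' (x - h) > 0"
    using DERIV_neg_dec_left[OF der2] \<open>f' x = 0\<close> by force
  define h where "h = min d e / 2"
  have h: "0 < h" "h < e" "h < d" using e assms(1) by (auto simp: h_def)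
  have "f (x - h) < f x"
  proof (rule DERIV_pos_imp_increasing_open[where f = f])
    show "x - h < x" using h by simp
    show "\<exists>D. (f has_real_derivative D) (at y) \<and> D > 0" if "x - h < y" "y < x" for y
      using der[of y] e(2)[of "x - y"] that h by (intro exI[of _ "f' y"]) auto
    show "continuous_on {x - h..x} f"
      using h by (auto intro!: continuous_at_imp_continuous_on DERIV_isCont[OF der])
  qed
  then show False using le[of "x - h"] h by force
qed

text \<open>Minimality in time is asked only of the past, so the test also applies at the final time
  of a rectangle.\<close>

lemma parabolic_at_min:
  fixes u :: "real \<Rightarrow> real \<Rightarrow> real" and ux :: "real \<Rightarrow> real"
  assumes "d > 0"
    and "((\<lambda>s. u s x) has_real_derivative ut) (at t)"
    and der: "\<And>y. \<bar>y - x\<bar> < d \<Longrightarrow> (u t has_real_derivative ux y) (at y)"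
    and "(ux has_real_derivative uxx) (at x)"
    and min_x: "\<And>y. \<bar>y - x\<bar> < d \<Longrightarrow> u t x \<le> u t y"
    and min_t: "\<And>s. t - d < s \<Longrightarrow> s < t \<Longrightarrow> u t x \<le> u s x"
  shows "ut \<le> 1/2 * uxx"
proof -
  have "ut \<le> 0"
    by (rule left_min_imp_deriv_nonpos[OF assms(2,1)]) (use min_t in auto)
  moreover have "ux x = 0"
    using DERIV_local_min[OF der[of x] \<open>d > 0\<close>] min_x \<open>d > 0\<close> by (auto simp: abs_minus_commute)
  then have "uxx \<ge> 0"
    by (intro left_min_imp_second_deriv_nonneg[of d x "u t" ux uxx] assms) auto
  ultimately show ?thesis by simp
qed

text \<open>A negative minimum over the compact rectangle avoids the initial edge and both sides. It
  thus lies inside or on the final edge, where \<open>parabolic_at_min\<close> contradicts the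
  strict inequality \<open>super\<close>.\<close>

lemma parabolic_min_principle:
  fixes u ut ux uxx :: "real \<Rightarrow> real \<Rightarrow> real"
  assumes "a \<le> b" "c < d"
    and cont: "continuous_on ({a..b} \<times> {c..d}) (\<lambda>(t, x). u t x)"
    and dt: "\<And>t x. t \<in> {a<..b} \<Longrightarrow> x \<in> {c<..<d} \<Longrightarrow>
      ((\<lambda>s. u s x) has_real_derivative ut t x) (at t)"
    and dx: "\<And>t x. t \<in> {a<..b} \<Longrightarrow> x \<in> {c<..<d} \<Longrightarrow> (u t has_real_derivative ux t x) (at x)"
    and dxx: "\<And>t x. t \<in> {a<..b} \<Longrightarrow> x \<in> {c<..<d} \<Longrightarrow> (ux t has_real_derivative uxx t x) (at x)"
    and super: "\<And>t x. t \<in> {a<..b} \<Longrightarrow> x \<in> {c<..<d} \<Longrightarrow> ut t x > 1/2 * uxx t x"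
    and init: "\<And>x. x \<in> {c..d} \<Longrightarrow> u a x \<ge> 0"
    and sides: "\<And>t. t \<in> {a..b} \<Longrightarrow> u t c \<ge> 0 \<and> u t d \<ge> 0"
    and "t \<in> {a..b}" "x \<in> {c..d}"
  shows "u t x \<ge> 0"
proof (rule ccontr)
  assume neg: "\<not> u t x \<ge> 0"
  have "compact ({a..b} \<times> {c..d})" by (intro compact_Times) auto
  moreover have "{a..b} \<times> {c..d} \<noteq> {}" using assms(1,2) by auto
  ultimately obtain p where p: "p \<in> {a..b} \<times> {c..d}"
    "\<forall>q \<in> {a..b} \<times> {c..d}. (\<lambda>(t, x). u t x) p \<le> (\<lambda>(t, x). u t x) q"
    using continuous_attains_inf[OF _ _ cont] by blast
  obtain t0 x0 where [simp]: "p = (t0, x0)" by (cases p)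
  have mem: "t0 \<in> {a..b}" "x0 \<in> {c..d}" using p(1) by auto
  have mn: "u t0 x0 \<le> u s y" if "s \<in> {a..b}" "y \<in> {c..d}" for s y
    using p(2) that by auto
  have "u t0 x0 < 0" using mn[of t x] neg \<open>t \<in> _\<close> \<open>x \<in> _\<close> by auto
  then have "t0 \<noteq> a" "x0 \<noteq> c" "x0 \<noteq> d"
    using init[of x0] sides[of t0] mem by auto
  then have int: "t0 \<in> {a<..b}" "x0 \<in> {c<..<d}" using mem by auto
  define e where "e = min (t0 - a) (min (x0 - c) (d - x0))"
  have "e > 0" using int by (auto simp: e_def)
  have *: "y \<in> {c<..<d}" if "\<bar>y - x0\<bar> < e" for y using that by (auto simp: e_def)
  have "ut t0 x0 \<le> 1/2 * uxx t0 x0"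
  proof (rule parabolic_at_min[where u = u and ux = "ux t0" and d = e and t = t0 and x = x0])
    show "u t0 x0 \<le> u t0 y" if "\<bar>y - x0\<bar> < e" for y
      using *[OF that] mem by (intro mn) auto
    show "u t0 x0 \<le> u t' x0" if "t0 - e < t'" "t' < t0" for t'
      using that mem by (intro mn) (auto simp: e_def)
  qed (use \<open>e > 0\<close> int dt dx dxx * in auto)
  then show False using super[OF int] by simp
qed

text \<open>The quadratic barrier \<open>b\<close> vanishes at \<open>(t0, x0)\<close> with positive
  slope and stays below \<open>u\<close>. The margin \<open>\<kappa>\<close> plays the part of
  interior positivity in the classical lemma: subtracting a small barrier leaves a strict
  supersolution, and \<open>u\<close> only has to be nonnegative.\<close>

lemma parabolic_hopf:
  fixes u ut ux uxx :: "real \<Rightarrow> real \<Rightarrow> real"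
  assumes "\<delta> > 0" "r > 0" "\<kappa> > 0"
    and cont: "continuous_on ({t0 - \<delta>..t0} \<times> {x0..x0 + r}) (\<lambda>(t, x). u t x)"
    and dt: "\<And>t x. t \<in> {t0 - \<delta><..t0} \<Longrightarrow> x \<in> {x0<..<x0 + r} \<Longrightarrow>
      ((\<lambda>s. u s x) has_real_derivative ut t x) (at t)"
    and dx: "\<And>t x. t \<in> {t0 - \<delta><..t0} \<Longrightarrow> x \<in> {x0<..<x0 + r} \<Longrightarrow>
      (u t has_real_derivative ux t x) (at x)"
    and dxx: "\<And>t x. t \<in> {t0 - \<delta><..t0} \<Longrightarrow> x \<in> {x0<..<x0 + r} \<Longrightarrow>
      (ux t has_real_derivative uxx t x) (at x)"
    and super: "\<And>t x. t \<in> {t0 - \<delta><..t0} \<Longrightarrow> x \<in> {x0<..<x0 + r} \<Longrightarrow>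
      ut t x - 1/2 * uxx t x \<ge> \<kappa>"
    and nonneg: "\<And>t x. t \<in> {t0 - \<delta>..t0} \<Longrightarrow> x \<in> {x0..x0 + r} \<Longrightarrow> u t x \<ge> 0"
    and zero: "u t0 x0 = 0"
    and D: "(u t0 has_real_derivative D) (at x0)"
  shows "D > 0"
proof -
  \<comment> \<open>\<open>K * \<delta>\<close> equals the maximum of
    \<open>r * y - y\<^sup>2\<close>, so \<open>b\<close> is nonpositive at the initial time. The
    operator maps \<open>b\<close> to \<open>\<eta> * (K + 1)\<close>, and \<open>\<eta>\<close>
    makes this \<open>\<kappa> / 2\<close>.\<close>
  define K where "K = r\<^sup>2 / (4 * \<delta>)"
  define \<eta> where "\<eta> = \<kappa> / (2 * (K + 1))"
  have K: "K > 0" "K * \<delta> = r\<^sup>2 / 4" using assms(1,2) by (auto simp: K_def)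
  have \<eta>: "\<eta> > 0" "\<eta> * (K + 1) < \<kappa>"
    using K(1) \<open>\<kappa> > 0\<close> by (auto simp: \<eta>_def field_simps intro: add_pos_pos)
  define b where "b = (\<lambda>t x. \<eta> * (r * (x - x0) - (x - x0)\<^sup>2 - K * (t0 - t)))"
  have ge: "u t x - b t x \<ge> 0" if "t \<in> {t0 - \<delta>..t0}" "x \<in> {x0..x0 + r}" for t x
  proof (rule parabolic_min_principle[where u = "\<lambda>t x. u t x - b t x" and a = "t0 - \<delta>" and b = t0
        and c = x0 and d = "x0 + r" and ut = "\<lambda>t x. ut t x - \<eta> * K"
        and ux = "\<lambda>t x. ux t x - \<eta> * (r - 2 * (x - x0))" and uxx = "\<lambda>t x. uxx t x + 2 * \<eta>"])
    show "continuous_on ({t0 - \<delta>..t0} \<times> {x0..x0 + r}) (\<lambda>(t, x). u t x - b t x)"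
      using cont unfolding b_def case_prod_unfold by (intro continuous_intros)
  next
    fix t x assume tx: "t \<in> {t0 - \<delta><..t0}" "x \<in> {x0<..<x0 + r}"
    show "((\<lambda>s. u s x - b s x) has_real_derivative ut t x - \<eta> * K) (at t)"
      unfolding b_def by (rule derivative_eq_intros dt[OF tx] refl | simp)+
    show "((\<lambda>x. u t x - b t x) has_real_derivative ux t x - \<eta> * (r - 2 * (x - x0))) (at x)"
      unfolding b_def by (rule derivative_eq_intros dx[OF tx] refl | simp)+
    show "((\<lambda>x. ux t x - \<eta> * (r - 2 * (x - x0))) has_real_derivative uxx t x + 2 * \<eta>) (at x)"
      by (rule derivative_eq_intros dxx[OF tx] refl | simp)+
    show "1/2 * (uxx t x + 2 * \<eta>) < ut t x - \<eta> * K"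
      using super[OF tx] \<eta> by (simp add: algebra_simps)
  next
    fix x assume x: "x \<in> {x0..x0 + r}"
    have "r * (x - x0) - (x - x0)\<^sup>2 \<le> K * \<delta>"
      using zero_le_power2[of "r/2 - (x - x0)"] unfolding K by (simp add: power2_eq_square field_simps)
    then have "b (t0 - \<delta>) x \<le> 0"
      using \<eta> by (auto simp: b_def mult_le_0_iff)
    then show "u (t0 - \<delta>) x - b (t0 - \<delta>) x \<ge> 0"
      using nonneg[of "t0 - \<delta>" x] x assms(1) by auto
  next
    fix t assume t: "t \<in> {t0 - \<delta>..t0}"
    have "b t x0 \<le> 0" "b t (x0 + r) \<le> 0"
      using \<eta> K t by (auto simp: b_def power2_eq_square mult_le_0_iff)
    then show "u t x0 - b t x0 \<ge> 0 \<and> u t (x0 + r) - b t (x0 + r) \<ge> 0"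
      using nonneg[of t x0] nonneg[of t "x0 + r"] t assms(2) by auto
  qed (use that assms(1,2) in auto)
  have der: "((\<lambda>x. u t0 x - b t0 x) has_real_derivative D - \<eta> * r) (at x0)"
    unfolding b_def by (rule derivative_eq_intros D refl | simp)+
  \<comment> \<open>\<open>u - b\<close> is nonnegative to the right of \<open>x0\<close> at time
    \<open>t0\<close> and zero at \<open>x0\<close>, so its slope there cannot be negative.\<close>
  have "D - \<eta> * r \<ge> 0"
  proof (rule ccontr)
    assume "\<not> D - \<eta> * r \<ge> 0"
    then obtain e where e: "e > 0"
      "\<And>h. 0 < h \<Longrightarrow> h < e \<Longrightarrow> u t0 x0 - b t0 x0 > u t0 (x0 + h) - b t0 (x0 + h)"
      using DERIV_neg_dec_right[OF der] by force
    define h where "h = min e r / 2"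
    have "0 < h" "h < e" "h < r" using e assms(2) by (auto simp: h_def)
    then show False
      using e(2)[of h] ge[of t0 "x0 + h"] assms(1) zero by (auto simp: b_def)
  qed
  then show ?thesis using \<eta>(1) \<open>r > 0\<close> by (smt (verit) mult_pos_pos)
qed

text \<open>At a contact point \<open>(t, L t)\<close> the barrier \<open>h\<close> has zero slope and is convex, hence increasing in
  time. As \<open>h\<close> exceeds its contact value wherever \<open>w\<close> vanishes identically, \<open>L\<close> lies to the left of
  the contact point just before \<open>t\<close>, so that Hopf's lemma applies on its right.\<close>

lemma free_boundary_comparison:
  fixes w wx wxx h ht hx hxx :: "real \<Rightarrow> real \<Rightarrow> real" and L :: "real \<Rightarrow> real"
  assumes "s \<le> T" "\<rho> > 0" "\<kappa> > 0"
    and w_cont: "continuous_on ({s..T} \<times> UNIV) (\<lambda>(t, x). w t x)"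
    and L_cont: "continuous_on {s..T} L"
    and w_left: "\<And>t x. t \<in> {s..T} \<Longrightarrow> x \<le> L t \<Longrightarrow> w t x = 0"
    and w_flat: "\<And>t. t \<in> {s<..T} \<Longrightarrow> (w t has_real_derivative 0) (at (L t))"
    and w_t: "\<And>t x. t \<in> {s<..T} \<Longrightarrow> L t < x \<Longrightarrow>
      ((\<lambda>s. w s x) has_real_derivative 1/2 * wxx t x) (at t)"
    and w_x: "\<And>t x. t \<in> {s<..T} \<Longrightarrow> L t < x \<Longrightarrow> (w t has_real_derivative wx t x) (at x)"
    and w_xx: "\<And>t x. t \<in> {s<..T} \<Longrightarrow> L t < x \<Longrightarrow> (wx t has_real_derivative wxx t x) (at x)"
    and h_cont: "continuous_on ({s..T} \<times> UNIV) (\<lambda>(t, x). h t x)"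
    and h_t: "\<And>t x. t \<in> {s<..T} \<Longrightarrow> ((\<lambda>s. h s x) has_real_derivative ht t x) (at t)"
    and h_x: "\<And>t x. t \<in> {s<..T} \<Longrightarrow> (h t has_real_derivative hx t x) (at x)"
    and h_xx: "\<And>t x. t \<in> {s<..T} \<Longrightarrow> (hx t has_real_derivative hxx t x) (at x)"
    and super: "\<And>t x. t \<in> {s<..T} \<Longrightarrow> ht t x - 1/2 * hxx t x \<ge> \<kappa>"
    and init: "\<And>x. \<bar>x\<bar> \<le> \<rho> \<Longrightarrow> w s x \<le> h s x"
    and outside: "\<And>t x. t \<in> {s..T} \<Longrightarrow> \<bar>x\<bar> \<ge> \<rho> \<Longrightarrow> w t x \<le> h t x"
    and "t \<in> {s..T}"
  shows "w t x \<le> h t x"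
proof (rule ccontr)
  assume neg: "\<not> w t x \<le> h t x"
  define z where "z = (\<lambda>t x. h t x - w t x)"
  have cont: "continuous_on ({s..T} \<times> UNIV) (\<lambda>(t, x). z t x)"
    unfolding z_def using continuous_on_diff[OF h_cont w_cont] by (simp add: case_prod_unfold)
  have "compact ({s..T} \<times> {-\<rho>..\<rho>})" by (intro compact_Times) auto
  moreover have "{s..T} \<times> {-\<rho>..\<rho>} \<noteq> {}" using assms(1,2) by auto
  ultimately obtain p where p: "p \<in> {s..T} \<times> {-\<rho>..\<rho>}"
    "\<forall>q \<in> {s..T} \<times> {-\<rho>..\<rho>}. (\<lambda>(t, x). z t x) p \<le> (\<lambda>(t, x). z t x) q"
    using continuous_attains_inf[OF _ _ continuous_on_subset[OF cont, of "{s..T} \<times> {-\<rho>..\<rho>}"]]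
    by blast
  obtain t0 x0 where [simp]: "p = (t0, x0)" by (cases p)
  have mem: "t0 \<in> {s..T}" "x0 \<in> {-\<rho>..\<rho>}" using p(1) by auto
  have mn0: "z t0 x0 \<le> z s' y" if "s' \<in> {s..T}" "y \<in> {-\<rho>..\<rho>}" for s' y
    using p(2) that by auto
  have "\<bar>x\<bar> < \<rho>" using outside[of t x] neg \<open>t \<in> _\<close> by force
  then have z_neg: "z t0 x0 < 0" using mn0[of t x] neg \<open>t \<in> _\<close> by (simp add: z_def abs_less_iff)
  \<comment> \<open>By \<open>outside\<close>, \<open>z\<close> is nonnegative for
    \<open>\<bar>y\<bar> \<ge> \<rho>\<close>, so the negative minimum over the compact rectangle is
    a minimum over the whole line.\<close>
  have mn: "z t0 x0 \<le> z s' y" if "s' \<in> {s..T}" for s' y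
    using mn0[of s' y] outside[of s' y] z_neg that by (force simp: z_def)
  have "t0 \<noteq> s" using z_neg init[of x0] mem by (auto simp: z_def abs_le_iff)
  then have t0: "t0 \<in> {s<..T}" "s < t0" using mem by auto
  have interior: "x0 = L t0"
  proof (rule ccontr)
    assume "x0 \<noteq> L t0"
    show False
    proof (cases "x0 < L t0")
      \<comment> \<open>Left of the boundary \<open>w\<close> is zero, also shortly before
        \<open>t0\<close> since \<open>L\<close> is continuous. Hence \<open>h\<close> itself has a
        local minimum, which its margin forbids.\<close>
      case True
      have h_min: "h t0 x0 \<le> h t' y" if "t' \<in> {s..T}" "y \<le> L t'" "x0 \<le> L t0" for t' y
        using mn[of t' y] w_left[of t' y] w_left[of t0 x0] that mem by (simp add: z_def)
      have "eventually (\<lambda>t. L t > x0) (at t0 within {s..T})"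
        using L_cont mem(1) True order_tendstoD(1)[of L "L t0" "at t0 within {s..T}" x0]
        by (auto simp: continuous_on_def)
      then obtain e where e: "e > 0" "\<And>t. t \<in> {s..T} \<Longrightarrow> t \<noteq> t0 \<Longrightarrow> dist t t0 < e \<Longrightarrow> L t > x0"
        unfolding eventually_at by auto
      define d where "d = min e (min (t0 - s) (L t0 - x0))"
      have d: "d > 0" "d \<le> e" "d \<le> t0 - s" "d \<le> L t0 - x0" using e t0 True by (auto simp: d_def)
      have "ht t0 x0 \<le> 1/2 * hxx t0 x0"
      proof (rule parabolic_at_min[where u = h and ux = "hx t0" and d = d and t = t0 and x = x0])
        show "h t0 x0 \<le> h t0 y" if "\<bar>y - x0\<bar> < d" for y
          using that d mem True by (intro h_min) auto
        show "h t0 x0 \<le> h s' x0" if "t0 - d < s'" "s' < t0" for s'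
          using that d mem True e(2)[of s'] by (intro h_min) (auto simp: dist_real_def)
      qed (use d h_t[OF t0(1)] h_x[OF t0(1)] h_xx[OF t0(1)] in auto)
      then show False using super[of t0 x0] t0 \<open>\<kappa> > 0\<close> by simp
    next
      \<comment> \<open>Right of the boundary the test applies to \<open>z\<close>. Derivatives are
        taken at time \<open>t0\<close> only, so the position of \<open>L\<close> at earlier times
        does not matter here.\<close>
      case False
      then have gt: "x0 > L t0" using \<open>x0 \<noteq> L t0\<close> by simp
      define d where "d = min (t0 - s) (x0 - L t0)"
      have d: "d > 0" "d \<le> t0 - s" "d \<le> x0 - L t0" using t0 gt by (auto simp: d_def)
      have "ht t0 x0 - 1/2 * wxx t0 x0 \<le> 1/2 * (hxx t0 x0 - wxx t0 x0)"
      proof (rule parabolic_at_min[where u = z and ux = "\<lambda>x. hx t0 x - wx t0 x"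
            and d = d and t = t0 and x = x0])
        show "((\<lambda>s. z s x0) has_real_derivative ht t0 x0 - 1/2 * wxx t0 x0) (at t0)"
          unfolding z_def using h_t[of t0 x0] w_t[of t0 x0] t0 gt by (intro DERIV_diff) auto
        show "(z t0 has_real_derivative hx t0 y - wx t0 y) (at y)" if "\<bar>y - x0\<bar> < d" for y
          unfolding z_def using h_x[of t0 y] w_x[of t0 y] t0 that d by (intro DERIV_diff) auto
        show "((\<lambda>x. hx t0 x - wx t0 x) has_real_derivative hxx t0 x0 - wxx t0 x0) (at x0)"
          using h_xx[of t0 x0] w_xx[of t0 x0] t0 gt by (intro DERIV_diff) auto
      qed (use d mem in \<open>auto intro!: mn\<close>)
      then show False using super[of t0 x0] t0 \<open>\<kappa> > 0\<close> by simp
    qed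
  qed
  have z_x: "(z t0 has_real_derivative hx t0 x0) (at x0)"
    unfolding z_def using DERIV_diff[OF h_x[OF t0(1), of x0] w_flat[OF t0(1), folded interior]] by simp
  then have hx0: "hx t0 x0 = 0"
    using DERIV_local_min[of "z t0" "hx t0 x0" x0 1] mn mem by auto
  \<comment> \<open>Where \<open>w\<close> vanishes, \<open>z\<close> equals \<open>h\<close>, so
    the minimum of \<open>z\<close> bounds \<open>h\<close> below on the whole region left of the
    boundary. Both the convexity of \<open>h\<close> at \<open>x0\<close> and the position of
    \<open>L\<close> before \<open>t0\<close> are read off from this.\<close>
  have h_min: "h t0 x0 \<le> h t' y" if "t' \<in> {s..T}" "y \<le> L t'" for t' y
    using mn[of t' y] w_left[of t' y] w_left[of t0 x0] that mem interior by (simp add: z_def)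
  have "hxx t0 x0 \<ge> 0"
    by (rule left_min_imp_second_deriv_nonneg[where f = "h t0" and f' = "hx t0" and d = 1 and x = x0])
      (use h_x[OF t0(1)] h_xx[OF t0(1)] hx0 h_min[OF mem(1)] interior in auto)
  then have "ht t0 x0 > 0" using super[of t0 x0] t0 \<open>\<kappa> > 0\<close> by simp
  then obtain e where e: "e > 0" "\<And>k. 0 < k \<Longrightarrow> k < e \<Longrightarrow> h (t0 - k) x0 < h t0 x0"
    using DERIV_pos_inc_left[OF h_t[of t0 x0]] t0 by force
  define \<delta> where "\<delta> = min e (t0 - s) / 2"
  have \<delta>: "\<delta> > 0" "\<delta> < e" "\<delta> < t0 - s" using e t0 by (auto simp: \<delta>_def)
  \<comment> \<open>If \<open>x0 \<le> L t'\<close> held at an earlier time, \<open>h_min\<close>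
    would give \<open>h t0 x0 \<le> h t' x0\<close>, against the strict growth of \<open>h\<close>
    in time. The width 1 of the strip is arbitrary.\<close>
  have dom: "L t' < y" if "t' \<in> {t0 - \<delta><..t0}" "y \<in> {x0<..<x0 + 1}" for t' y
  proof (cases "t' = t0")
    case False
    then have "h t' x0 < h t0 x0" using e(2)[of "t0 - t'"] that \<delta> by auto
    moreover have "h t0 x0 \<le> h t' x0" if "x0 \<le> L t'"
      using that \<open>t' \<in> _\<close> \<delta> mem by (intro h_min) auto
    ultimately show ?thesis using that by force
  qed (use that interior in auto)
  have sub: "t' \<in> {s<..T}" if "t' \<in> {t0 - \<delta><..t0}" for t' using that \<delta> mem by auto
  have "hx t0 x0 > 0"
  proof (rule parabolic_hopf[where u = "\<lambda>t x. z t x - z t0 x0" and \<delta> = \<delta> and r = 1 and \<kappa> = \<kappa>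
        and ?t0.0 = t0 and ?x0.0 = x0 and ut = "\<lambda>t x. ht t x - 1/2 * wxx t x"
        and ux = "\<lambda>t x. hx t x - wx t x" and uxx = "\<lambda>t x. hxx t x - wxx t x"])
    have "continuous_on ({t0 - \<delta>..t0} \<times> {x0..x0 + 1}) (\<lambda>(t, x). z t x)"
      by (rule continuous_on_subset[OF cont]) (use \<delta> mem in auto)
    then show "continuous_on ({t0 - \<delta>..t0} \<times> {x0..x0 + 1}) (\<lambda>(t, x). z t x - z t0 x0)"
      unfolding case_prod_unfold by (intro continuous_intros)
    fix t x assume tx: "t \<in> {t0 - \<delta><..t0}" "x \<in> {x0<..<x0 + 1}"
    show "((\<lambda>s. z s x - z t0 x0) has_real_derivative ht t x - 1/2 * wxx t x) (at t)"
      unfolding z_def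
      by (rule derivative_eq_intros h_t[OF sub[OF tx(1)]] w_t[OF sub[OF tx(1)] dom[OF tx]] refl | simp)+
    show "((\<lambda>x. z t x - z t0 x0) has_real_derivative hx t x - wx t x) (at x)"
      unfolding z_def
      by (rule derivative_eq_intros h_x[OF sub[OF tx(1)]] w_x[OF sub[OF tx(1)] dom[OF tx]] refl | simp)+
    show "((\<lambda>x. hx t x - wx t x) has_real_derivative hxx t x - wxx t x) (at x)"
      by (intro DERIV_diff h_xx[OF sub[OF tx(1)]] w_xx[OF sub[OF tx(1)] dom[OF tx]])
    show "ht t x - 1/2 * wxx t x - 1/2 * (hxx t x - wxx t x) \<ge> \<kappa>"
      using super[OF sub[OF tx(1)], of x] by (simp add: algebra_simps)
  next
    show "((\<lambda>x. z t0 x - z t0 x0) has_real_derivative hx t0 x0) (at x0)"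
      using DERIV_diff[OF z_x DERIV_const] by simp
  qed (use \<open>\<kappa> > 0\<close> \<delta> mem in \<open>auto intro!: mn\<close>)
  then show False using hx0 by simp
qed

subsection \<open>Gaussian convolution\<close>

text \<open>The Gaussian density of variance \<open>\<tau>\<close>, which is the normalization
  belonging to half the second derivative.\<close>

definition heat_kernel :: "real \<Rightarrow> real \<Rightarrow> real" where
  "heat_kernel \<tau> x = exp (- x\<^sup>2 / (2 * \<tau>)) / sqrt (2 * pi * \<tau>)"

lemma heat_kernel_nonneg: "\<tau> > 0 \<Longrightarrow> heat_kernel \<tau> x \<ge> 0"
  by (simp add: heat_kernel_def)

lemma heat_kernel_eq_normal_density:
  "\<tau> > 0 \<Longrightarrow> heat_kernel \<tau> (x - y) = normal_density x (sqrt \<tau>) y"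
  by (simp add: heat_kernel_def normal_density_def power2_commute[of x y])

lemma has_integral_has_bochner:
  fixes f :: "'a::euclidean_space \<Rightarrow> real"
  assumes "has_bochner_integral lborel f I"
  shows "(f has_integral I) UNIV"
  using has_integral_integral_lborel[of f] assms by (simp add: has_bochner_integral_iff)

lemma heat_kernel_has_integral:
  assumes "\<tau> > 0"
  shows "((\<lambda>y. heat_kernel \<tau> (x - y)) has_integral 1) UNIV"
    and "((\<lambda>y. heat_kernel \<tau> (x - y) * (y - x)\<^sup>2) has_integral \<tau>) UNIV"
proof -
  have "has_bochner_integral lborel (\<lambda>y. normal_density x (sqrt \<tau>) y * (y - x) ^ (2 * k))
      (fact (2 * k) / ((2 / \<tau>) ^ k * fact k))" for k
    using normal_moment_even[of "sqrt \<tau>" x k] assms by simp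
  then have *: "((\<lambda>y. normal_density x (sqrt \<tau>) y * (y - x) ^ (2 * k)) has_integral
      (fact (2 * k) / ((2 / \<tau>) ^ k * fact k))) UNIV" for k
    by (rule has_integral_has_bochner)
  show "((\<lambda>y. heat_kernel \<tau> (x - y)) has_integral 1) UNIV"
    using *[of 0] assms by (simp add: heat_kernel_eq_normal_density)
  show "((\<lambda>y. heat_kernel \<tau> (x - y) * (y - x)\<^sup>2) has_integral \<tau>) UNIV"
    using *[of 1] assms by (simp add: heat_kernel_eq_normal_density fact_numeral)
qed

lemma heat_kernel_deriv_x:
  assumes "\<tau> > 0"
  shows "((\<lambda>x. heat_kernel \<tau> (x - y)) has_real_derivative
    - (x - y) / \<tau> * heat_kernel \<tau> (x - y)) (at x)"
proof -
  have "((\<lambda>x. - (x - y)\<^sup>2 / (2 * \<tau>)) has_real_derivative - (x - y) / \<tau>) (at x)"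
    using assms by (auto intro!: derivative_eq_intros simp: field_simps)
  from DERIV_cdivide[OF DERIV_fun_exp[OF this], of "sqrt (2 * pi * \<tau>)"]
  show ?thesis unfolding heat_kernel_def by (simp add: mult.commute)
qed

lemma heat_kernel_deriv_xx:
  assumes "\<tau> > 0"
  shows "((\<lambda>x. - (x - y) / \<tau> * heat_kernel \<tau> (x - y)) has_real_derivative
    ((x - y)\<^sup>2 / \<tau>\<^sup>2 - 1 / \<tau>) * heat_kernel \<tau> (x - y)) (at x)"
proof -
  have "((\<lambda>x. - (x - y) / \<tau>) has_real_derivative - 1 / \<tau>) (at x)"
    using assms by (auto intro!: derivative_eq_intros)
  from DERIV_mult[OF this heat_kernel_deriv_x[OF assms]]
  show ?thesis by (rule DERIV_cong) (simp add: field_simps power2_eq_square)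
qed

lemma heat_kernel_deriv_t:
  assumes "\<tau> > 0"
  shows "((\<lambda>\<tau>. heat_kernel \<tau> x) has_real_derivative
    1/2 * (x\<^sup>2 / \<tau>\<^sup>2 - 1 / \<tau>) * heat_kernel \<tau> x) (at \<tau>)"
proof -
  define E where "E = exp (- x\<^sup>2 / (2 * \<tau>))"
  define q where "q = sqrt (2 * pi * \<tau>)"
  have q: "q > 0" "q * q = 2 * pi * \<tau>" using assms by (auto simp: q_def)
  have "((\<lambda>\<tau>. - x\<^sup>2 / (2 * \<tau>)) has_real_derivative x\<^sup>2 / (2 * \<tau>\<^sup>2)) (at \<tau>)"
    using assms by (auto intro!: derivative_eq_intros simp: power2_eq_square field_simps)
  from DERIV_fun_exp[OF this]
  have 1: "((\<lambda>\<tau>. exp (- x\<^sup>2 / (2 * \<tau>))) has_real_derivative E * (x\<^sup>2 / (2 * \<tau>\<^sup>2))) (at \<tau>)"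
    by (simp add: E_def)
  have "((\<lambda>\<tau>. sqrt (2 * pi * \<tau>)) has_real_derivative
      inverse (sqrt (2 * pi * \<tau>)) / 2 * (2 * pi)) (at \<tau>)"
    by (rule DERIV_chain2[OF DERIV_real_sqrt DERIV_cmult_Id]) (use assms in simp)
  then have 2: "((\<lambda>\<tau>. sqrt (2 * pi * \<tau>)) has_real_derivative pi / q) (at \<tau>)"
    by (simp add: q_def field_simps)
  have "((\<lambda>\<tau>. heat_kernel \<tau> x) has_real_derivative
      (E * (x\<^sup>2 / (2 * \<tau>\<^sup>2)) * q - E * (pi / q)) / (q * q)) (at \<tau>)"
    using DERIV_divide[OF 1 2 less_imp_neq[OF q(1)[unfolded q_def], THEN not_sym]]
    unfolding heat_kernel_def E_def q_def .
  moreover have "(E * (x\<^sup>2 / (2 * \<tau>\<^sup>2)) * q - E * (pi / q)) / (q * q) =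
      1/2 * (x\<^sup>2 / \<tau>\<^sup>2 - 1 / \<tau>) * heat_kernel \<tau> x"
  proof -
    have "(E * (x\<^sup>2 / (2 * \<tau>\<^sup>2)) * q - E * (pi / q)) / (q * q) =
      E / q * (x\<^sup>2 / (2 * \<tau>\<^sup>2) - pi / (q * q))"
      using q(1) by (simp add: field_simps)
    also have "pi / (q * q) = 1 / (2 * \<tau>)"
      unfolding q(2) using assms by simp
    finally show ?thesis
      by (simp add: heat_kernel_def E_def q_def algebra_simps)
  qed
  ultimately show ?thesis by (rule DERIV_cong)
qed

lemma continuous_on_heat_kernel:
  assumes "continuous_on S f" "continuous_on S g" "\<And>p. p \<in> S \<Longrightarrow> f p > 0"
  shows "continuous_on S (\<lambda>p. heat_kernel (f p) (g p))"
  unfolding heat_kernel_def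
  by (intro continuous_intros assms) (use assms(3) in force)+

section \<open>Differentiating Gaussian convolutions under the integral sign\<close>

lemma leibniz_rule_weighted:
  fixes k k' :: "real \<Rightarrow> real \<Rightarrow> real" and f :: "real \<Rightarrow> real"
  assumes "open U" "convex U" "x \<in> U"
    and "\<And>x y. x \<in> U \<Longrightarrow> ((\<lambda>x. k x y) has_real_derivative k' x y) (at x)"
    and k': "continuous_on (U \<times> {a..b}) (\<lambda>p. k' (fst p) (snd p))"
    and k: "\<And>x. x \<in> U \<Longrightarrow> continuous_on {a..b} (k x)"
    and f: "continuous_on {a..b} f"
  shows "((\<lambda>x. integral {a..b} (\<lambda>y. k x y * f y)) has_real_derivative
    integral {a..b} (\<lambda>y. k' x y * f y)) (at x)"
proof -
  have "((\<lambda>x. integral (cbox a b) (\<lambda>y. k x y * f y)) has_real_derivative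
    integral (cbox a b) (\<lambda>y. k' x y * f y)) (at x within U)"
  proof (rule leibniz_rule_field_derivative[where f = "\<lambda>x y. k x y * f y" and fx = "\<lambda>x y. k' x y * f y"])
    show "((\<lambda>x. k x y * f y) has_real_derivative k' x y * f y) (at x within U)" if "x \<in> U" for x y
      by (rule DERIV_cmult_right[OF has_field_derivative_at_within[OF assms(4)[OF that]]])
    show "(\<lambda>y. k x y * f y) integrable_on cbox a b" if "x \<in> U" for x
      unfolding cbox_interval
      by (intro integrable_continuous_interval continuous_intros k f that)
    show "continuous_on (U \<times> cbox a b) (\<lambda>(x, y). k' x y * f y)"
      unfolding cbox_interval case_prod_unfold
      by (intro continuous_intros k' continuous_on_compose2[OF f]) auto
  qed (fact assms)+
  then show ?thesis
    unfolding cbox_interval at_within_open[OF \<open>x \<in> U\<close> \<open>open U\<close>] .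
qed

text \<open>Integrating over \<open>{-R..R}\<close> keeps differentiation under the integral on a
  compact interval. For \<open>f\<close> vanishing outside it, this is the convolution over the
  whole line.\<close>

definition heat_conv :: "(real \<Rightarrow> real) \<Rightarrow> real \<Rightarrow> real \<Rightarrow> real \<Rightarrow> real" where
  "heat_conv f R \<tau> x = integral {-R..R} (\<lambda>y. heat_kernel \<tau> (x - y) * f y)"

definition heat_conv_x :: "(real \<Rightarrow> real) \<Rightarrow> real \<Rightarrow> real \<Rightarrow> real \<Rightarrow> real" where
  "heat_conv_x f R \<tau> x = integral {-R..R} (\<lambda>y. - (x - y) / \<tau> * heat_kernel \<tau> (x - y) * f y)"

definition heat_conv_xx :: "(real \<Rightarrow> real) \<Rightarrow> real \<Rightarrow> real \<Rightarrow> real \<Rightarrow> real" where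
  "heat_conv_xx f R \<tau> x =
    integral {-R..R} (\<lambda>y. ((x - y)\<^sup>2 / \<tau>\<^sup>2 - 1 / \<tau>) * heat_kernel \<tau> (x - y) * f y)"

context
  fixes f :: "real \<Rightarrow> real" and R :: real
  assumes f: "continuous_on {-R..R} f"
begin

lemma heat_conv_deriv_x:
  assumes "\<tau> > 0"
  shows "(heat_conv f R \<tau> has_real_derivative heat_conv_x f R \<tau> x) (at x)"
  unfolding heat_conv_def heat_conv_x_def
proof (rule leibniz_rule_weighted[where U = UNIV])
  show "((\<lambda>x. heat_kernel \<tau> (x - y)) has_real_derivative
      - (x - y) / \<tau> * heat_kernel \<tau> (x - y)) (at x)" for x y
    by (rule heat_kernel_deriv_x[OF assms])
qed (use assms in \<open>auto intro!: continuous_intros continuous_on_heat_kernel f\<close>)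

lemma heat_conv_deriv_xx:
  assumes "\<tau> > 0"
  shows "(heat_conv_x f R \<tau> has_real_derivative heat_conv_xx f R \<tau> x) (at x)"
  unfolding heat_conv_x_def heat_conv_xx_def
proof (rule leibniz_rule_weighted[where U = UNIV])
  show "((\<lambda>x. - (x - y) / \<tau> * heat_kernel \<tau> (x - y)) has_real_derivative
      ((x - y)\<^sup>2 / \<tau>\<^sup>2 - 1 / \<tau>) * heat_kernel \<tau> (x - y)) (at x)" for x y
    by (rule heat_kernel_deriv_xx[OF assms])
qed (use assms in \<open>auto intro!: continuous_intros continuous_on_heat_kernel f\<close>)

lemma heat_conv_deriv_t:
  assumes "\<tau> > 0"
  shows "((\<lambda>\<tau>. heat_conv f R \<tau> x) has_real_derivative 1/2 * heat_conv_xx f R \<tau> x) (at \<tau>)"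
proof -
  have "((\<lambda>\<tau>. integral {-R..R} (\<lambda>y. heat_kernel \<tau> (x - y) * f y)) has_real_derivative
    integral {-R..R} (\<lambda>y. 1/2 * ((x - y)\<^sup>2 / \<tau>\<^sup>2 - 1 / \<tau>) * heat_kernel \<tau> (x - y) * f y)) (at \<tau>)"
  proof (rule leibniz_rule_weighted[where U = "{0<..}"])
    show "((\<lambda>\<tau>. heat_kernel \<tau> (x - y)) has_real_derivative
        1/2 * ((x - y)\<^sup>2 / \<tau>\<^sup>2 - 1 / \<tau>) * heat_kernel \<tau> (x - y)) (at \<tau>)" if "\<tau> \<in> {0<..}" for \<tau> y
      using heat_kernel_deriv_t that by simp
  qed (use assms in \<open>auto intro!: continuous_intros continuous_on_heat_kernel f\<close>)
  then show ?thesis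
    by (simp add: heat_conv_def heat_conv_xx_def mult.assoc flip: integral_mult_right)
qed

lemma continuous_on_heat_conv:
  assumes "continuous_on S g" "\<And>p. p \<in> S \<Longrightarrow> g p > 0" "continuous_on S h"
  shows "continuous_on S (\<lambda>p. heat_conv f R (g p) (h p))"
proof -
  have "continuous_on (S \<times> cbox (-R) R) (\<lambda>(p, y). heat_kernel (g p) (h p - y) * f y)"
    unfolding case_prod_unfold
    by (intro continuous_intros continuous_on_heat_kernel continuous_on_compose2[OF assms(1)]
        continuous_on_compose2[OF assms(3)] continuous_on_compose2[OF f]) (use assms in auto)
  then show ?thesis
    unfolding heat_conv_def using integral_continuous_on_param by fastforce
qed

end

section \<open>Bounds for Gaussian averages and their behaviour at small times\<close>

lemma has_integral_heat_conv:
  assumes "\<tau> > 0" "continuous_on {-R..R} f" "\<And>y. \<bar>y\<bar> > R \<Longrightarrow> f y = 0"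
  shows "((\<lambda>y. heat_kernel \<tau> (x - y) * f y) has_integral heat_conv f R \<tau> x) UNIV"
proof (rule has_integral_on_superset)
  have "(\<lambda>y. heat_kernel \<tau> (x - y) * f y) integrable_on {-R..R}"
    by (intro integrable_continuous_interval continuous_intros continuous_on_heat_kernel assms)
  then show "((\<lambda>y. heat_kernel \<tau> (x - y) * f y) has_integral heat_conv f R \<tau> x) {-R..R}"
    unfolding heat_conv_def by (rule integrable_integral)
  show "heat_kernel \<tau> (x - y) * f y = 0" if "y \<notin> {-R..R}" for y
    using assms(3)[of y] that by force
qed simp

lemma abs_heat_conv_le:
  assumes "\<tau> > 0" "continuous_on {-R..R} f" "\<And>y. \<bar>y\<bar> > R \<Longrightarrow> f y = 0"
    and "\<And>y. \<bar>f y\<bar> \<le> 1"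
  shows "\<bar>heat_conv f R \<tau> x\<bar> \<le> 1"
proof -
  note I = has_integral_heat_conv[OF assms(1-3), of x]
  note K = heat_kernel_has_integral(1)[OF assms(1), of x]
  have f: "f y \<le> 1" "f y \<ge> -1" for y using assms(4)[of y] by linarith+
  have "heat_conv f R \<tau> x \<le> 1"
  proof (rule has_integral_le[OF I K])
    fix y show "heat_kernel \<tau> (x - y) * f y \<le> heat_kernel \<tau> (x - y)"
      using mult_left_mono[OF f(1)[of y] heat_kernel_nonneg[OF assms(1), of "x - y"]] by simp
  qed
  moreover have "- 1 \<le> heat_conv f R \<tau> x"
  proof (rule has_integral_le[OF has_integral_neg[OF K] I])
    fix y show "- heat_kernel \<tau> (x - y) \<le> heat_kernel \<tau> (x - y) * f y"
      using mult_left_mono[OF f(2)[of y] heat_kernel_nonneg[OF assms(1), of "x - y"]] by simp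
  qed
  ultimately show ?thesis by linarith
qed

text \<open>Chebyshev's argument, uniform in \<open>x\<close>: nearby values of \<open>f\<close>
  differ little by uniform continuity, and for distant ones the trivial bound 2 is absorbed by a
  multiple of \<open>(y - x)\<^sup>2\<close>, whose Gaussian mean is the variance.\<close>

lemma heat_conv_approx:
  assumes f: "continuous_on UNIV f" and supp: "\<And>y. \<bar>y\<bar> > R \<Longrightarrow> f y = 0"
    and bound: "\<And>y. \<bar>f y\<bar> \<le> 1" and "\<epsilon> > 0"
  obtains \<delta> where "0 < \<delta>" "\<And>x. \<bar>heat_conv f R \<delta> x - f x\<bar> \<le> \<epsilon>"
proof -
  have "uniformly_continuous_on {-R-1..R+1} f"
    using f by (intro compact_uniformly_continuous continuous_on_subset[OF f]) auto
  then obtain d where d: "d > 0" "\<And>x y. x \<in> {-R-1..R+1} \<Longrightarrow> y \<in> {-R-1..R+1} \<Longrightarrow>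
      dist y x < d \<Longrightarrow> dist (f y) (f x) < \<epsilon> / 2"
    unfolding uniformly_continuous_on_def using \<open>\<epsilon> > 0\<close> by (metis half_gt_zero)
  \<comment> \<open>The cap 1 ensures that if one of two points closer than \<open>\<eta>\<close>
    leaves \<open>{-R-1..R+1}\<close>, then both lie where \<open>f\<close> vanishes.\<close>
  define \<eta> where "\<eta> = min d 1"
  have \<eta>: "\<eta> > 0" "\<eta> \<le> d" "\<eta> \<le> 1" using d by (auto simp: \<eta>_def)
  have near: "\<bar>f y - f x\<bar> \<le> \<epsilon> / 2" if "\<bar>y - x\<bar> < \<eta>" for x y
  proof (cases "x \<in> {-R-1..R+1} \<and> y \<in> {-R-1..R+1}")
    case True
    then show ?thesis using d(2)[of x y] that \<eta> by (auto simp: dist_real_def)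
  next
    case False
    then have "\<bar>x\<bar> > R" "\<bar>y\<bar> > R" using that \<eta> by (auto simp: abs_real_def split: if_splits)
    then show ?thesis using supp \<open>\<epsilon> > 0\<close> by simp
  qed
  have est: "\<bar>f y - f x\<bar> \<le> \<epsilon> / 2 + 2 / \<eta>\<^sup>2 * (y - x)\<^sup>2" for x y
  proof (cases "\<bar>y - x\<bar> < \<eta>")
    case True
    then show ?thesis
      using near[OF True] \<eta> by (smt (verit) divide_nonneg_nonneg mult_nonneg_nonneg zero_le_power2)
  next
    case False
    then have "\<eta>\<^sup>2 \<le> (y - x)\<^sup>2" using \<eta> by (simp add: abs_le_square_iff[symmetric])
    then have "2 / \<eta>\<^sup>2 * (y - x)\<^sup>2 \<ge> 2" using \<eta> by (simp add: field_simps)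
    then show ?thesis using bound[of x] bound[of y] \<open>\<epsilon> > 0\<close> by linarith
  qed
  \<comment> \<open>The variance term \<open>2 / \<eta>\<^sup>2 * \<delta>\<close> is then exactly
    \<open>\<epsilon> / 2\<close>.\<close>
  define \<delta> where "\<delta> = \<epsilon> * \<eta>\<^sup>2 / 4"
  have \<delta>: "0 < \<delta>" using \<eta> \<open>\<epsilon> > 0\<close> by (simp add: \<delta>_def)
  have small: "\<epsilon> / 2 + 2 / \<eta>\<^sup>2 * \<delta> \<le> \<epsilon>"
    using \<eta> by (simp add: \<delta>_def)
  have "\<bar>heat_conv f R \<delta> x - f x\<bar> \<le> \<epsilon>" for x
  proof -
    let ?k = "\<lambda>y. heat_kernel \<delta> (x - y)"
    note K = heat_kernel_has_integral[OF \<delta>, of x]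
    have I: "((\<lambda>y. ?k y * f y - ?k y * f x) has_integral heat_conv f R \<delta> x - 1 * f x) UNIV"
      using \<delta> supp continuous_on_subset[OF f]
      by (intro has_integral_diff has_integral_heat_conv has_integral_mult_left K) auto
    have J: "((\<lambda>y. ?k y * (\<epsilon> / 2) + ?k y * (y - x)\<^sup>2 * (2 / \<eta>\<^sup>2)) has_integral
        1 * (\<epsilon> / 2) + \<delta> * (2 / \<eta>\<^sup>2)) UNIV"
      by (intro has_integral_add has_integral_mult_left K)
    have le: "\<bar>?k y * f y - ?k y * f x\<bar> \<le> ?k y * (\<epsilon> / 2) + ?k y * (y - x)\<^sup>2 * (2 / \<eta>\<^sup>2)" for y
    proof -
      have "\<bar>?k y * f y - ?k y * f x\<bar> = ?k y * \<bar>f y - f x\<bar>"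
        using heat_kernel_nonneg[OF \<delta>, of "x - y"]
        by (simp add: abs_mult flip: right_diff_distrib)
      also have "\<dots> \<le> ?k y * (\<epsilon> / 2 + 2 / \<eta>\<^sup>2 * (y - x)\<^sup>2)"
        by (intro mult_left_mono est heat_kernel_nonneg \<delta>)
      finally show ?thesis by (simp add: algebra_simps)
    qed
    have "heat_conv f R \<delta> x - 1 * f x \<le> 1 * (\<epsilon> / 2) + \<delta> * (2 / \<eta>\<^sup>2)"
      by (rule has_integral_le[OF I J]) (use le in \<open>simp add: abs_le_iff\<close>)
    moreover have "- (1 * (\<epsilon> / 2) + \<delta> * (2 / \<eta>\<^sup>2)) \<le> heat_conv f R \<delta> x - 1 * f x"
    proof (rule has_integral_le[OF has_integral_neg[OF J] I])
      fix y show "- (?k y * (\<epsilon> / 2) + ?k y * (y - x)\<^sup>2 * (2 / \<eta>\<^sup>2)) \<le> ?k y * f y - ?k y * f x"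
        using le[of y] by linarith
    qed
    ultimately show ?thesis using small by (simp add: abs_le_iff mult.commute)
  qed
  then show ?thesis using that \<delta> by blast
qed

section \<open>Entire extension of Gaussian averages in the space variable\<close>

definition complex_heat_conv :: "(real \<Rightarrow> real) \<Rightarrow> real \<Rightarrow> real \<Rightarrow> complex \<Rightarrow> complex" where
  "complex_heat_conv f R \<tau> z = integral {-R..R}
    (\<lambda>y. exp (- (z - of_real y)\<^sup>2 / of_real (2 * \<tau>)) * of_real (f y / sqrt (2 * pi * \<tau>)))"

lemma complex_heat_conv_of_real:
  assumes "continuous_on {-R..R} f" "\<tau> > 0"
  shows "complex_heat_conv f R \<tau> (of_real x) = of_real (heat_conv f R \<tau> x)"
proof -
  have eq: "exp (- (complex_of_real x - of_real y)\<^sup>2 / of_real (2 * \<tau>)) *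
      of_real (f y / sqrt (2 * pi * \<tau>)) =
      of_real (heat_kernel \<tau> (x - y) * f y)" for y
    unfolding heat_kernel_def by (simp flip: exp_of_real)
  have "((\<lambda>y. heat_kernel \<tau> (x - y) * f y) has_integral heat_conv f R \<tau> x) {-R..R}"
    unfolding heat_conv_def
    by (intro integrable_integral integrable_continuous_interval
        continuous_intros continuous_on_heat_kernel assms)
  from has_integral_of_real[OF this, THEN integral_unique] show ?thesis
    unfolding complex_heat_conv_def eq .
qed

lemma holomorphic_complex_heat_conv:
  assumes "continuous_on {-R..R} f" "\<tau> > 0"
  shows "complex_heat_conv f R \<tau> holomorphic_on UNIV"
proof -
  let ?g = "\<lambda>z y. exp (- (z - of_real y)\<^sup>2 / of_real (2 * \<tau>)) * of_real (f y / sqrt (2 * pi * \<tau>))"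
  let ?g' = "\<lambda>(z :: complex) y. exp (- (z - of_real y)\<^sup>2 / of_real (2 * \<tau>)) *
    (- (2 * (z - of_real y)) / of_real (2 * \<tau>)) * of_real (f y / sqrt (2 * pi * \<tau>))"
  have "(\<lambda>z. integral (cbox (-R) R) (?g z)) holomorphic_on UNIV"
  proof (rule leibniz_rule_holomorphic[where fx = ?g'])
    fix z :: complex and y
    have "((\<lambda>z. - (z - of_real y)\<^sup>2 / of_real (2 * \<tau>)) has_field_derivative
      - (2 * (z - of_real y)) / of_real (2 * \<tau>)) (at z)"
      using assms by (auto intro!: derivative_eq_intros simp: field_simps)
    from DERIV_cmult_right[OF DERIV_fun_exp[OF this], of "of_real (f y / sqrt (2 * pi * \<tau>))"]
    show "((\<lambda>z. ?g z y) has_field_derivative ?g' z y) (at z)" .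
    have "continuous_on {-R..R} (?g z)"
      by (intro continuous_intros assms) (use assms in auto)
    then show "?g z integrable_on cbox (-R) R"
      using integrable_continuous_interval by simp
  next
    have *: "continuous_on (UNIV \<times> cbox (-R) R) (\<lambda>p. f (snd p))"
      by (rule continuous_on_compose2[OF assms(1)]) (auto intro: continuous_intros)
    show "continuous_on (UNIV \<times> cbox (-R) R) (\<lambda>(z, y). ?g' z y)"
      unfolding case_prod_unfold by (intro continuous_intros *) (use assms in auto)
  qed auto
  then show ?thesis unfolding complex_heat_conv_def by simp
qed

text \<open>The real part of \<open>- (z - y)\<^sup>2\<close> is
  \<open>(Im z)\<^sup>2 - (Re z - y)\<^sup>2\<close>, so taking moduli leaves a real Gaussian
  average times a growth factor. The bound depends neither on \<open>f\<close> nor on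
  \<open>R\<close>, as a normal-family argument requires.\<close>

lemma norm_complex_heat_conv_le:
  assumes f: "continuous_on {-R..R} f" and "\<tau> > 0"
    and supp: "\<And>y. \<bar>y\<bar> > R \<Longrightarrow> f y = 0" and bound: "\<And>y. \<bar>f y\<bar> \<le> 1"
  shows "norm (complex_heat_conv f R \<tau> z) \<le> exp ((Im z)\<^sup>2 / (2 * \<tau>))"
proof -
  let ?g = "\<lambda>y. exp (- (z - of_real y)\<^sup>2 / of_real (2 * \<tau>)) * of_real (f y / sqrt (2 * pi * \<tau>))"
  let ?E = "exp ((Im z)\<^sup>2 / (2 * \<tau>))"
  have "norm (?g y) = ?E * (heat_kernel \<tau> (Re z - y) * \<bar>f y\<bar>)" for y
  proof -
    have "Re (- (z - of_real y)\<^sup>2 / of_real (2 * \<tau>)) =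
        (Im z)\<^sup>2 / (2 * \<tau>) + (- (Re z - y)\<^sup>2 / (2 * \<tau>))"
      by (simp only: Re_divide_of_real) (simp add: power2_eq_square diff_divide_distrib)
    then have "norm (exp (- (z - of_real y)\<^sup>2 / of_real (2 * \<tau>))) =
        ?E * exp (- (Re z - y)\<^sup>2 / (2 * \<tau>))"
      by (simp only: norm_exp_eq_Re exp_add)
    moreover have "norm (complex_of_real (f y / sqrt (2 * pi * \<tau>))) = \<bar>f y\<bar> / sqrt (2 * pi * \<tau>)"
      using \<open>\<tau> > 0\<close> by (simp only: norm_of_real abs_divide) simp
    ultimately show ?thesis
      unfolding norm_mult heat_kernel_def by simp
  qed
  moreover have int: "((\<lambda>y. ?E * (heat_kernel \<tau> (Re z - y) * \<bar>f y\<bar>)) has_integral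
      ?E * heat_conv (\<lambda>y. \<bar>f y\<bar>) R \<tau> (Re z)) {-R..R}"
    unfolding heat_conv_def
    by (intro has_integral_mult_right integrable_integral integrable_continuous_interval
        continuous_intros continuous_on_heat_kernel assms)
  moreover have "?g integrable_on {-R..R}"
    by (intro integrable_continuous_interval continuous_intros assms) (use assms in auto)
  ultimately have "norm (integral {-R..R} ?g) \<le>
      integral {-R..R} (\<lambda>y. ?E * (heat_kernel \<tau> (Re z - y) * \<bar>f y\<bar>))"
    by (intro Henstock_Kurzweil_Integration.integral_norm_bound_integral) (blast, blast, metis order_refl)
  also have "\<dots> = ?E * heat_conv (\<lambda>y. \<bar>f y\<bar>) R \<tau> (Re z)"
    using int by (rule integral_unique)
  finally have "norm (complex_heat_conv f R \<tau> z) \<le> ?E * heat_conv (\<lambda>y. \<bar>f y\<bar>) R \<tau> (Re z)"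
    unfolding complex_heat_conv_def .
  also have "\<dots> \<le> ?E * 1"
    using abs_heat_conv_le[of \<tau> R "\<lambda>y. \<bar>f y\<bar>" "Re z"] assms continuous_on_rabs[OF f]
    by (intro mult_left_mono) auto
  finally show ?thesis by simp
qed

subsection \<open>Vanishing of the difference\<close>

definition flat_caloric :: "(real \<Rightarrow> real) \<Rightarrow> (real \<Rightarrow> real \<Rightarrow> real) \<Rightarrow> bool" where
  "flat_caloric L w \<longleftrightarrow>
     continuous_on {0<..} L \<and> continuous_on ({0<..} \<times> UNIV) (\<lambda>(t, x). w t x) \<and>
     (\<forall>t>0. \<forall>x\<le>L t. w t x = 0) \<and> (\<forall>t>0. (w t has_real_derivative 0) (at (L t))) \<and>
     (\<exists>wx wxx. \<forall>t>0. \<forall>x>L t.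
        ((\<lambda>s. w s x) has_real_derivative 1/2 * wxx t x) (at t) \<and>
        (w t has_real_derivative wx t x) (at x) \<and> (wx t has_real_derivative wxx t x) (at x))"

text \<open>Turns the one-sided comparison into a two-sided estimate.\<close>

lemma flat_caloric_minus:
  assumes "flat_caloric L w"
  shows "flat_caloric L (\<lambda>t x. - w t x)"
proof -
  obtain wx wxx where w: "\<And>t x. t > 0 \<Longrightarrow> x > L t \<Longrightarrow>
      ((\<lambda>s. w s x) has_real_derivative 1/2 * wxx t x) (at t) \<and>
      (w t has_real_derivative wx t x) (at x) \<and> (wx t has_real_derivative wxx t x) (at x)"
    using assms unfolding flat_caloric_def by blast
  have "((\<lambda>s. - w s x) has_real_derivative 1/2 * - wxx t x) (at t) \<and>
      ((\<lambda>x. - w t x) has_real_derivative - wx t x) (at x) \<and>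
      ((\<lambda>x. - wx t x) has_real_derivative - wxx t x) (at x)" if "t > 0" "x > L t" for t x
    using w[OF that] by (auto dest: DERIV_minus)
  moreover have "((\<lambda>x. - w t x) has_real_derivative 0) (at (L t))" if "t > 0" for t
    using assms that DERIV_minus[where f = "w t" and D = 0] unfolding flat_caloric_def by simp
  moreover have "continuous_on ({0<..} \<times> UNIV) (\<lambda>(t, x). - w t x)"
    using assms continuous_on_minus[of "{0<..} \<times> UNIV" "\<lambda>(t, x). w t x"]
    unfolding flat_caloric_def by (simp add: case_prod_unfold)
  ultimately show ?thesis
    using assms unfolding flat_caloric_def
    by (intro conjI exI[of _ "\<lambda>t x. - wx t x"] exI[of _ "\<lambda>t x. - wxx t x"]) auto
qed

text \<open>Each correction to \<open>F\<close> has its task. The term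
  \<open>x\<^sup>2 + (t - s)\<close> solves the heat equation, and its factor
  \<open>2 / \<rho>\<^sup>2\<close> makes it dominate \<open>w - F\<close>, at most 2, once
  \<open>\<bar>x\<bar> \<ge> \<rho>\<close>. The constant \<open>\<epsilon>\<close> absorbs the
  initial error, and \<open>\<epsilon> * (t - s)\<close> supplies the margin of the
  supersolution.\<close>

lemma flat_caloric_le_caloric:
  fixes F Fx Fxx :: "real \<Rightarrow> real \<Rightarrow> real"
  assumes w: "flat_caloric L w" "\<And>t x. t > 0 \<Longrightarrow> \<bar>w t x\<bar> \<le> 1"
    and "0 < s" "s \<le> t" "\<epsilon> > 0" "\<rho> > 0"
    and F_cont: "continuous_on ({s..t} \<times> UNIV) (\<lambda>(t, x). F t x)"
    and F_t: "\<And>t' x. t' \<in> {s<..t} \<Longrightarrow> ((\<lambda>s. F s x) has_real_derivative 1/2 * Fxx t' x) (at t')"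
    and F_x: "\<And>t' x. t' \<in> {s<..t} \<Longrightarrow> (F t' has_real_derivative Fx t' x) (at x)"
    and F_xx: "\<And>t' x. t' \<in> {s<..t} \<Longrightarrow> (Fx t' has_real_derivative Fxx t' x) (at x)"
    and F_bound: "\<And>t' x. t' \<in> {s..t} \<Longrightarrow> \<bar>F t' x\<bar> \<le> 1"
    and init: "\<And>x. \<bar>x\<bar> \<le> \<rho> \<Longrightarrow> w s x \<le> F s x + \<epsilon>"
  shows "w t x \<le> F t x + (\<epsilon> * (1 + (t - s)) + 2 / \<rho>\<^sup>2 * (x\<^sup>2 + (t - s)))"
proof -
  obtain wx wxx where w_der: "\<And>t x. t > 0 \<Longrightarrow> x > L t \<Longrightarrow>
      ((\<lambda>s. w s x) has_real_derivative 1/2 * wxx t x) (at t) \<and>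
      (w t has_real_derivative wx t x) (at x) \<and> (wx t has_real_derivative wxx t x) (at x)"
    using w(1) unfolding flat_caloric_def by blast
  have w_cont: "continuous_on ({0<..} \<times> UNIV) (\<lambda>(t, x). w t x)"
    and L_cont: "continuous_on {0<..} L"
    and w_left: "\<And>t x. t > 0 \<Longrightarrow> x \<le> L t \<Longrightarrow> w t x = 0"
    and w_flat: "\<And>t. t > 0 \<Longrightarrow> (w t has_real_derivative 0) (at (L t))"
    using w(1) unfolding flat_caloric_def by auto
  define c where "c = 2 / \<rho>\<^sup>2"
  have c: "c > 0" "c * \<rho>\<^sup>2 = 2" using \<open>\<rho> > 0\<close> by (auto simp: c_def)
  define h where "h = (\<lambda>t x. F t x + (\<epsilon> * (1 + (t - s)) + c * (x\<^sup>2 + (t - s))))"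
  have pos: "\<epsilon> * (t' - s) \<ge> 0" "c * (t' - s) \<ge> 0" if "t' \<in> {s..t}" for t'
    using that c \<open>\<epsilon> > 0\<close> by auto
  have "w t x \<le> h t x"
  proof (rule free_boundary_comparison[where s = s and T = t and \<rho> = \<rho> and \<kappa> = \<epsilon> and w = w and L = L
        and wx = wx and wxx = wxx and ht = "\<lambda>t x. 1/2 * Fxx t x + (\<epsilon> + c)"
        and hx = "\<lambda>t x. Fx t x + 2 * c * x" and hxx = "\<lambda>t x. Fxx t x + 2 * c"])
    show "continuous_on ({s..t} \<times> UNIV) (\<lambda>(t, x). w t x)"
      by (rule continuous_on_subset[OF w_cont]) (use \<open>0 < s\<close> in auto)
    show "continuous_on {s..t} L"
      by (rule continuous_on_subset[OF L_cont]) (use \<open>0 < s\<close> in auto)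
    show "continuous_on ({s..t} \<times> UNIV) (\<lambda>(t, x). h t x)"
      using F_cont unfolding h_def case_prod_unfold by (intro continuous_intros)
  next
    fix t' x assume t': "t' \<in> {s<..t}"
    show "((\<lambda>s. h s x) has_real_derivative 1/2 * Fxx t' x + (\<epsilon> + c)) (at t')"
      unfolding h_def using c
      by (intro DERIV_add F_t t') (auto intro!: derivative_eq_intros)
    show "(h t' has_real_derivative Fx t' x + 2 * c * x) (at x)"
      unfolding h_def by (intro DERIV_add F_x t') (auto intro!: derivative_eq_intros)
    show "((\<lambda>x. Fx t' x + 2 * c * x) has_real_derivative Fxx t' x + 2 * c) (at x)"
      by (intro DERIV_add F_xx t') (auto intro!: derivative_eq_intros)
    show "\<epsilon> \<le> 1/2 * Fxx t' x + (\<epsilon> + c) - 1/2 * (Fxx t' x + 2 * c)"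
      by (simp add: algebra_simps)
    {
      assume "L t' < x"
      with w_der[of t' x] t' \<open>0 < s\<close>
      show "((\<lambda>s. w s x) has_real_derivative 1/2 * wxx t' x) (at t')"
        "(w t' has_real_derivative wx t' x) (at x)" "(wx t' has_real_derivative wxx t' x) (at x)"
        by auto
    }
  next
    fix x :: real assume "\<bar>x\<bar> \<le> \<rho>"
    then have "w s x \<le> F s x + \<epsilon>" by (rule init)
    moreover have "0 \<le> c * x\<^sup>2" using c by simp
    ultimately show "w s x \<le> h s x"
      by (simp only: h_def diff_self add_0_right mult_1_right)
  next
    fix t' x :: real assume t': "t' \<in> {s..t}" and "\<rho> \<le> \<bar>x\<bar>"
    then have "\<rho>\<^sup>2 \<le> x\<^sup>2" using \<open>\<rho> > 0\<close> by (simp add: abs_le_square_iff[symmetric])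
    then have "2 \<le> c * x\<^sup>2" using mult_left_mono[of "\<rho>\<^sup>2" "x\<^sup>2" c] c by simp
    moreover have "w t' x \<le> 1" "F t' x \<ge> -1"
      using w(2)[of t' x] F_bound[of t' x] t' \<open>0 < s\<close> by (auto simp: abs_le_iff)
    ultimately show "w t' x \<le> h t' x"
      using pos[OF t'] \<open>\<epsilon> > 0\<close> by (simp add: h_def distrib_left)
  qed (use \<open>0 < s\<close> \<open>s \<le> t\<close> \<open>\<epsilon> > 0\<close> \<open>\<rho> > 0\<close> w_left w_flat in auto)
  then show ?thesis by (simp add: h_def c_def)
qed

lemma flat_caloric_zero:
  assumes w: "flat_caloric L w" and bound: "\<And>t x. t > 0 \<Longrightarrow> \<bar>w t x\<bar> \<le> 1" and "t > 0"
  shows "w t x = 0"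
proof -
  \<comment> \<open>Any time strictly between 0 and \<open>t\<close> would serve: \<open>w s\<close>
    is continuous, and \<open>t - s > 0\<close> leaves time for Gaussian smoothing.\<close>
  define s where "s = t / 2"
  have s: "0 < s" "s \<le> t" "0 < t - s" using \<open>t > 0\<close> by (auto simp: s_def)
  define R where "R = (\<lambda>n :: nat. real n + 2)"
  \<comment> \<open>The cutoff is 1 for \<open>\<bar>y\<bar> \<le> n + 1\<close>, the interval used
    as \<open>\<rho>\<close> in the comparison, and falls continuously to 0 at
    \<open>R n\<close>.\<close>
  define f where "f = (\<lambda>n y. w s y * max 0 (min 1 (R n - \<bar>y\<bar>)))"
  have "continuous_on UNIV (w s)"
  proof -
    have "continuous_on ({0<..} \<times> UNIV) (\<lambda>p. w (fst p) (snd p))"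
      using w unfolding flat_caloric_def case_prod_unfold by blast
    then have "continuous_on UNIV (\<lambda>x. w (fst (s, x)) (snd (s, x)))"
      by (rule continuous_on_compose2) (use s in \<open>auto intro!: continuous_intros\<close>)
    then show ?thesis by simp
  qed
  then have f_cont: "continuous_on S (f n)" for n S
    unfolding f_def by (intro continuous_intros) (auto intro: continuous_on_subset)
  have f_supp: "f n y = 0" if "\<bar>y\<bar> > R n" for n y
    using that by (simp add: f_def)
  have f_eq: "f n y = w s y" if "\<bar>y\<bar> \<le> real n + 1" for n y
    using that by (simp add: f_def R_def)
  have f_bound: "\<bar>f n y\<bar> \<le> 1" for n y
    using mult_mono[OF bound[OF s(1), of y], of "\<bar>max 0 (min 1 (R n - \<bar>y\<bar>))\<bar>" 1]
    by (simp add: f_def abs_mult)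
  have "\<exists>d>0. \<forall>x. \<bar>heat_conv (f n) (R n) d x - f n x\<bar> \<le> 1 / (real n + 1)" for n
  proof -
    have e: "0 < 1 / (real n + 1)" by simp
    obtain d where "0 < d" "\<And>x. \<bar>heat_conv (f n) (R n) d x - f n x\<bar> \<le> 1 / (real n + 1)"
      by (rule heat_conv_approx[of "f n" "R n", OF f_cont _ f_bound e])
        (erule f_supp, rule that)
    then show ?thesis by auto
  qed
  then obtain \<delta> where \<delta>: "\<And>n. 0 < \<delta> n"
    "\<And>n x. \<bar>heat_conv (f n) (R n) (\<delta> n) x - f n x\<bar> \<le> 1 / (real n + 1)"
    by metis
  define err where "err = (\<lambda>(n::nat) x. 1 / (real n + 1) * (1 + (t - s)) + 2 / (real n + 1)\<^sup>2 * (x\<^sup>2 + (t - s)))"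
  \<comment> \<open>The shift by \<open>\<delta> n\<close> starts the evolution from a slightly
    smoothed profile, so the kernel is never evaluated at time zero. The error is that of the
    comparison with \<open>\<epsilon> = 1 / (n + 1)\<close> and
    \<open>\<rho> = n + 1\<close>.\<close>
  have close: "\<bar>heat_conv (f n) (R n) (t - s + \<delta> n) x - w t x\<bar> \<le> err n x" for n x
  proof -
    let ?F = "\<lambda>t x. heat_conv (f n) (R n) (t - s + \<delta> n) x"
    let ?Fx = "\<lambda>t x. heat_conv_x (f n) (R n) (t - s + \<delta> n) x"
    let ?Fxx = "\<lambda>t x. heat_conv_xx (f n) (R n) (t - s + \<delta> n) x"
    have \<tau>: "t' - s + \<delta> n > 0" if "t' \<in> {s..t}" for t' using that \<delta>(1)[of n] by simp
    have F_cont: "continuous_on ({s..t} \<times> UNIV) (\<lambda>(t, x). ?F t x)"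
      unfolding case_prod_unfold
      by (intro continuous_on_heat_conv f_cont continuous_intros) (use \<tau> in auto)
    have F_t: "((\<lambda>t. ?F t x) has_real_derivative 1/2 * ?Fxx t' x) (at t')" if "t' \<in> {s<..t}" for t' x
    proof -
      have "((\<lambda>t. t - s + \<delta> n) has_real_derivative 1) (at t')"
        by (auto intro!: derivative_eq_intros)
      from DERIV_chain2[OF heat_conv_deriv_t[OF f_cont \<tau>] this] that show ?thesis by simp
    qed
    have F_x: "(?F t' has_real_derivative ?Fx t' x) (at x)" if "t' \<in> {s<..t}" for t' x
      using heat_conv_deriv_x[OF f_cont \<tau>] that by simp
    have F_xx: "(?Fx t' has_real_derivative ?Fxx t' x) (at x)" if "t' \<in> {s<..t}" for t' x
      using heat_conv_deriv_xx[OF f_cont \<tau>] that by simp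
    have F_bound: "\<bar>?F t' x\<bar> \<le> 1" if "t' \<in> {s..t}" for t' x
      using abs_heat_conv_le[OF \<tau>[OF that] f_cont f_supp f_bound] by simp
    have init: "\<bar>?F s x - w s x\<bar> \<le> 1 / (real n + 1)" if "\<bar>x\<bar> \<le> real n + 1" for x
      using \<delta>(2)[of n x] f_eq[OF that] by simp
    have "w t x \<le> ?F t x + err n x"
      unfolding err_def
    proof (rule flat_caloric_le_caloric[OF w bound s(1,2), where F = ?F and Fx = ?Fx and Fxx = ?Fxx])
      show "w s x \<le> ?F s x + 1 / (real n + 1)" if "\<bar>x\<bar> \<le> real n + 1" for x
        using init[OF that] by (simp only: abs_le_iff) linarith
    qed (use F_cont F_t F_x F_xx F_bound in auto)
    moreover have "- w t x \<le> - ?F t x + err n x"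
      unfolding err_def
    proof (rule flat_caloric_le_caloric[OF flat_caloric_minus[OF w] _ s(1,2), where F = "\<lambda>t x. - ?F t x"
          and Fx = "\<lambda>t x. - ?Fx t x" and Fxx = "\<lambda>t x. - ?Fxx t x"])
      show "- w s x \<le> - ?F s x + 1 / (real n + 1)" if "\<bar>x\<bar> \<le> real n + 1" for x
        using init[OF that] by (simp only: abs_le_iff) linarith
      show "continuous_on ({s..t} \<times> UNIV) (\<lambda>(t, x). - ?F t x)"
        using continuous_on_minus[OF F_cont] by (simp add: case_prod_unfold)
    next
      fix t' x assume t': "t' \<in> {s<..t}"
      show "((\<lambda>t. - ?F t x) has_real_derivative 1/2 * - ?Fxx t' x) (at t')"
        using DERIV_minus[OF F_t[OF t', of x]] by simp
      show "((\<lambda>x. - ?F t' x) has_real_derivative - ?Fx t' x) (at x)"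
        by (rule DERIV_minus[OF F_x[OF t', of x]])
      show "((\<lambda>x. - ?Fx t' x) has_real_derivative - ?Fxx t' x) (at x)"
        by (rule DERIV_minus[OF F_xx[OF t', of x]])
    qed (use bound F_bound in auto)
    ultimately show ?thesis by (simp only: abs_le_iff) linarith
  qed
  have lim: "(\<lambda>n. heat_conv (f n) (R n) (t - s + \<delta> n) x) \<longlonglongrightarrow> w t x" for x
  proof -
    have "(\<lambda>n. 1 / (real n + 1)) \<longlonglongrightarrow> 0"
      using LIMSEQ_inverse_real_of_nat by (simp add: inverse_eq_divide add.commute)
    then have "(\<lambda>n. 1 / (real n + 1) * (1 + (t - s)) + 2 * (1 / (real n + 1))\<^sup>2 * (x\<^sup>2 + (t - s)))
        \<longlonglongrightarrow> 0 * (1 + (t - s)) + 2 * 0\<^sup>2 * (x\<^sup>2 + (t - s))"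
      by (intro tendsto_intros)
    then have "(\<lambda>n. err n x) \<longlonglongrightarrow> 0"
      by (simp add: err_def power_divide)
    then have "(\<lambda>n. heat_conv (f n) (R n) (t - s + \<delta> n) x - w t x) \<longlonglongrightarrow> 0"
      by (rule Lim_null_comparison[rotated]) (use close in auto)
    then show ?thesis by (rule LIM_zero_cancel)
  qed
  define G where "G = (\<lambda>n. complex_heat_conv (f n) (R n) (t - s + \<delta> n))"
  have \<tau>: "0 < t - s + \<delta> n" "t - s \<le> t - s + \<delta> n" for n using s \<delta>(1)[of n] by simp_all
  \<comment> \<open>Replacing \<open>t - s + \<delta> n\<close> by the smaller \<open>t - s\<close>
    removes the dependence on \<open>n\<close>, so the family is bounded on every compact
    set.\<close>
  have G_le: "norm (G n z) \<le> exp ((Im z)\<^sup>2 / (2 * (t - s)))" for n z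
  proof -
    have "norm (G n z) \<le> exp ((Im z)\<^sup>2 / (2 * (t - s + \<delta> n)))"
      unfolding G_def by (rule norm_complex_heat_conv_le[OF f_cont \<tau>(1) f_supp f_bound])
    also have "\<dots> \<le> exp ((Im z)\<^sup>2 / (2 * (t - s)))"
      unfolding exp_le_cancel_iff using s \<tau> by (intro divide_left_mono mult_pos_pos) auto
    finally show ?thesis .
  qed
  obtain g r where g: "g holomorphic_on UNIV" "strict_mono r" "\<And>z. (\<lambda>n. G (r n) z) \<longlonglongrightarrow> g z"
  proof (rule Montel[where S = UNIV and \<H> = "range G" and \<F> = G])
    show "h holomorphic_on UNIV" if "h \<in> range G" for h
      using that holomorphic_complex_heat_conv[OF f_cont \<tau>(1)] by (auto simp: G_def)
    show "\<exists>B. \<forall>h\<in>range G. \<forall>z\<in>K. norm (h z) \<le> B" if "compact K" for K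
    proof -
      obtain B where B: "\<And>z. z \<in> K \<Longrightarrow> norm z \<le> B"
        using compact_imp_bounded[OF \<open>compact K\<close>] unfolding bounded_iff by blast
      have "norm (G n z) \<le> exp (B\<^sup>2 / (2 * (t - s)))" if "z \<in> K" for n z
      proof (rule order_trans[OF G_le])
        have "\<bar>Im z\<bar> \<le> \<bar>B\<bar>" using abs_Im_le_cmod[of z] B[OF that] by linarith
        then show "exp ((Im z)\<^sup>2 / (2 * (t - s))) \<le> exp (B\<^sup>2 / (2 * (t - s)))"
          using s by (simp add: divide_right_mono abs_le_square_iff)
      qed
      then show ?thesis by blast
    qed
  qed auto
  \<comment> \<open>On the real axis the full sequence converges to \<open>w t\<close>, which
    identifies the limit of the subsequence.\<close>
  have g_real: "g (of_real y) = of_real (w t y)" for y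
  proof (rule LIMSEQ_unique[OF g(3)])
    have "(\<lambda>n. of_real (heat_conv (f (r n)) (R (r n)) (t - s + \<delta> (r n)) y)) \<longlonglongrightarrow> complex_of_real (w t y)"
      by (intro tendsto_of_real LIMSEQ_subseq_LIMSEQ[OF lim g(2), unfolded o_def])
    then show "(\<lambda>n. G (r n) (of_real y)) \<longlonglongrightarrow> of_real (w t y)"
      unfolding G_def complex_heat_conv_of_real[OF f_cont \<tau>(1)] .
  qed
  have "g (of_real x) = 0"
  \<comment> \<open>The zeros known so far lie on a real half-line, which has empty interior in the
    plane; they accumulate at \<open>L t\<close>, and that is enough for the identity
    theorem.\<close>
  proof (rule analytic_continuation[OF g(1), where U = "of_real ` {..L t}" and \<xi> = "of_real (L t)"])
    show "complex_of_real (L t) islimpt of_real ` {..L t}"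
      unfolding islimpt_approachable
    proof (intro allI impI)
      fix e :: real assume "e > 0"
      then show "\<exists>z\<in>complex_of_real ` {..L t}. z \<noteq> of_real (L t) \<and> dist z (of_real (L t)) < e"
        by (intro bexI[of _ "of_real (L t - e / 2)"]) (auto simp: dist_norm simp flip: of_real_diff)
    qed
    show "g z = 0" if "z \<in> of_real ` {..L t}" for z
      using that g_real w \<open>t > 0\<close> unfolding flat_caloric_def by auto
  qed auto
  then show ?thesis using g_real[of x] by simp
qed

section \<open>Recovering the initial data from the solution\<close>

lemma L1_loc_tendsto_unique_AE:
  assumes "L1_loc_tendsto U f F" "L1_loc_tendsto V g F" "F \<noteq> bot"
    and eq: "\<forall>\<^sub>F i in F. U i = V i"
  shows "AE x in lborel. f x = g x"
proof -
  have ae: "AE x in lborel. x \<in> cball 0 (real n) \<longrightarrow> f x = g x" for n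
  proof -
    let ?K = "cball (0::real) (real n)"
    have f: "\<forall>\<^sub>F i in F. set_integrable lborel ?K (\<lambda>x. U i x - f x)"
      "((\<lambda>i. LINT x:?K|lborel. \<bar>U i x - f x\<bar>) \<longlongrightarrow> 0) F"
      using assms(1) unfolding L1_loc_tendsto_def by auto
    have g: "\<forall>\<^sub>F i in F. set_integrable lborel ?K (\<lambda>x. V i x - g x)"
      "((\<lambda>i. LINT x:?K|lborel. \<bar>V i x - g x\<bar>) \<longlongrightarrow> 0) F"
      using assms(2) unfolding L1_loc_tendsto_def by auto
    \<comment> \<open>Since \<open>U i = V i\<close>, the function \<open>g - f\<close> is
      \<open>(U i - f) - (V i - g)\<close>. Its integrability is recorded along with the estimate,
      because a zero Bochner integral of a non-integrable function would give no
      information.\<close>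
    have good: "\<forall>\<^sub>F i in F. set_integrable lborel ?K (\<lambda>x. g x - f x) \<and>
        (LINT x:?K|lborel. \<bar>g x - f x\<bar>) \<le>
        (LINT x:?K|lborel. \<bar>U i x - f x\<bar>) + (LINT x:?K|lborel. \<bar>V i x - g x\<bar>)"
      using f(1) g(1) eq
    proof eventually_elim
      case (elim i)
      have int: "set_integrable lborel ?K (\<lambda>x. g x - f x)"
        using set_integral_diff(1)[OF elim(1,2)] by (simp add: elim(3))
      have "(LINT x:?K|lborel. \<bar>g x - f x\<bar>) \<le>
          (LINT x:?K|lborel. \<bar>U i x - f x\<bar> + \<bar>V i x - g x\<bar>)"
        using elim int
        by (intro set_integral_mono set_integral_add set_integrable_abs) auto
      also have "\<dots> = (LINT x:?K|lborel. \<bar>U i x - f x\<bar>) + (LINT x:?K|lborel. \<bar>V i x - g x\<bar>)"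
        using elim by (intro set_integral_add set_integrable_abs) auto
      finally show ?case using int by blast
    qed
    have int: "set_integrable lborel ?K (\<lambda>x. g x - f x)"
      using eventually_happens'[OF \<open>F \<noteq> bot\<close> good] by blast
    have "(LINT x:?K|lborel. \<bar>g x - f x\<bar>) \<le> 0 + 0"
      by (rule tendsto_lowerbound[OF tendsto_add[OF f(2) g(2)] _ \<open>F \<noteq> bot\<close>])
        (use good in eventually_elim, blast)
    moreover have "(LINT x:?K|lborel. \<bar>g x - f x\<bar>) \<ge> 0"
      unfolding set_lebesgue_integral_def by (intro Bochner_Integration.integral_nonneg) auto
    ultimately have "(LINT x|lborel. indicat_real ?K x *\<^sub>R \<bar>g x - f x\<bar>) = 0"
      unfolding set_lebesgue_integral_def by linarith
    moreover have "integrable lborel (\<lambda>x. indicat_real ?K x *\<^sub>R \<bar>g x - f x\<bar>)"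
      using set_integrable_abs[OF int] unfolding set_integrable_def .
    ultimately have "AE x in lborel. indicat_real ?K x *\<^sub>R \<bar>g x - f x\<bar> = 0"
      by (subst (asm) integral_nonneg_eq_0_iff_AE) auto
    then show ?thesis by eventually_elim (auto simp: indicator_def split: if_splits)
  qed
  have "AE x in lborel. \<forall>n. x \<in> cball 0 (real n) \<longrightarrow> f x = g x"
    unfolding AE_all_countable using ae by blast
  then show ?thesis
  proof eventually_elim
    case (elim x)
    obtain n where "\<bar>x\<bar> \<le> real n" using real_arch_simple by blast
    then show ?case using elim by (auto simp: dist_real_def)
  qed
qed

text \<open>A difference at one point persists on an interval to its right, and that interval has
  positive measure.\<close>

lemma right_continuous_AE_eq:
  fixes f g :: "real \<Rightarrow> real"
  assumes ae: "AE x in lborel. f x = g x"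
    and "\<And>x. continuous (at_right x) f" "\<And>x. continuous (at_right x) g"
  shows "f = g"
proof (rule ccontr)
  assume "f \<noteq> g"
  then obtain x where x: "f x - g x \<noteq> 0" by fastforce
  have "((\<lambda>y. f y - g y) \<longlongrightarrow> f x - g x) (at_right x)"
    using assms(2,3)[of x] by (intro tendsto_diff) (auto simp: continuous_within)
  then have "\<forall>\<^sub>F y in at_right x. f y - g y \<noteq> 0"
    using x by (rule tendsto_imp_eventually_ne)
  then obtain b where b: "b > x" "\<And>y. x < y \<Longrightarrow> y < b \<Longrightarrow> f y \<noteq> g y"
    unfolding eventually_at_right_field by auto
  have "AE y in lborel. y \<notin> {x<..<b}"
    using ae by eventually_elim (use b(2) in auto)
  then have "emeasure lborel {x<..<b} = 0"
    by (subst (asm) AE_iff_measurable[where N = "{x<..<b}"]) auto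
  then show False using b(1) by simp
qed

section \<open>From two classical solutions to their weighted difference\<close>

lemma classical_solution_DERIV:
  assumes "classical_solution U0 U L" "t > 0" "x > L t"
  shows "((\<lambda>s. U s x) has_real_derivative 1/2 * deriv_x (deriv_x U) t x + U t x) (at t)"
    and "(U t has_real_derivative deriv_x U t x) (at x)"
    and "(deriv_x U t has_real_derivative deriv_x (deriv_x U) t x) (at x)"
proof -
  have "\<forall>(t, x) \<in> {(t, x). t > 0 \<and> x > L t}.
        (\<lambda>s. U s x) field_differentiable (at t) \<and>
        (\<lambda>y. U t y) field_differentiable (at x) \<and>
        (\<lambda>y. deriv_x U t y) field_differentiable (at x)"
    using assms(1) unfolding classical_solution_def C12_on_def by blast
  then have d: "(\<lambda>s. U s x) field_differentiable (at t)" "U t field_differentiable (at x)"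
    "deriv_x U t field_differentiable (at x)" using assms(2,3) by auto
  \<comment> \<open>\<open>deriv\<close> is a total function, so the equation yields an actual
    derivative only together with the differentiability in \<open>d\<close>.\<close>
  have "deriv_t U t x = 1/2 * deriv_x (deriv_x U) t x + U t x"
    using assms unfolding classical_solution_def FBP_def by blast
  then show "((\<lambda>s. U s x) has_real_derivative 1/2 * deriv_x (deriv_x U) t x + U t x) (at t)"
    using d(1) unfolding deriv_t_def by (metis DERIV_deriv_iff_field_differentiable)
  show "(U t has_real_derivative deriv_x U t x) (at x)"
    using d(2) unfolding deriv_x_def by (simp add: DERIV_deriv_iff_field_differentiable)
  have "deriv_x (deriv_x U) t x = deriv (deriv_x U t) x"
    unfolding deriv_x_def[of "deriv_x U"] ..
  then show "(deriv_x U t has_real_derivative deriv_x (deriv_x U) t x) (at x)"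
    using d(3) by (simp add: DERIV_deriv_iff_field_differentiable)
qed

lemma classical_solution_flat:
  assumes "classical_solution U0 U L" "t > 0"
  shows "x \<le> L t \<Longrightarrow> U t x = 1" and "(U t has_real_derivative 0) (at (L t))"
  using assms unfolding classical_solution_def FBP_def by auto

text \<open>The derivative of \<open>exp (- t)\<close> cancels the zero-order term of the equation
  and leaves the pure heat equation. Since the boundaries coincide, the values 1 and the zero slopes
  subtract on the same curve.\<close>

lemma classical_solution_diff_flat_caloric:
  assumes 1: "classical_solution U0_1 U1 L1" and 2: "classical_solution U0_2 U2 L2"
    and L: "\<And>t. t > 0 \<Longrightarrow> L1 t = L2 t"
  shows "flat_caloric L1 (\<lambda>t x. exp (- t) * (U1 t x - U2 t x))"
proof -
  let ?wx = "\<lambda>t x. exp (- t) * (deriv_x U1 t x - deriv_x U2 t x)"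
  let ?wxx = "\<lambda>t x. exp (- t) * (deriv_x (deriv_x U1) t x - deriv_x (deriv_x U2) t x)"
  have L_cont: "continuous_on {0<..} L1"
    using 1 unfolding classical_solution_def by blast
  have w_cont: "continuous_on ({0<..} \<times> UNIV) (\<lambda>(t, x). exp (- t) * (U1 t x - U2 t x))"
    using 1 2 unfolding classical_solution_def case_prod_unfold
    by (intro continuous_intros) auto
  have left: "exp (- t) * (U1 t x - U2 t x) = 0" if "t > 0" "x \<le> L1 t" for t x
    using classical_solution_flat(1)[OF 1, of t x] classical_solution_flat(1)[OF 2, of t x] L that
    by simp
  have flat: "((\<lambda>x. exp (- t) * (U1 t x - U2 t x)) has_real_derivative 0) (at (L1 t))"
    if "t > 0" for t
    using DERIV_cmult[OF DERIV_diff[OF classical_solution_flat(2)[OF 1 that]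
        classical_solution_flat(2)[OF 2 that, folded L[OF that]]], of "exp (- t)"] by simp
  have eqn: "((\<lambda>s. exp (- s) * (U1 s x - U2 s x)) has_real_derivative 1/2 * ?wxx t x) (at t) \<and>
      ((\<lambda>x. exp (- t) * (U1 t x - U2 t x)) has_real_derivative ?wx t x) (at x) \<and>
      (?wx t has_real_derivative ?wxx t x) (at x)" if "t > 0" "x > L1 t" for t x
  proof -
    have x2: "x > L2 t" using L that by simp
    have e: "((\<lambda>s. exp (- s)) has_real_derivative - exp (- t)) (at t)"
      by (auto intro!: derivative_eq_intros)
    note D1 = classical_solution_DERIV[OF 1 that] and D2 = classical_solution_DERIV[OF 2 that(1) x2]
    have "((\<lambda>s. exp (- s) * (U1 s x - U2 s x)) has_real_derivative 1/2 * ?wxx t x) (at t)"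
      by (rule DERIV_cong[OF DERIV_mult[OF e DERIV_diff[OF D1(1) D2(1)]]]) (simp add: algebra_simps)
    then show ?thesis
      using DERIV_cmult[OF DERIV_diff[OF D1(2) D2(2)]] DERIV_cmult[OF DERIV_diff[OF D1(3) D2(3)]]
      by blast
  qed
  show ?thesis
    unfolding flat_caloric_def
    by (rule conjI[OF L_cont] conjI[OF w_cont] conjI allI impI left flat exI[of _ ?wx] exI[of _ ?wxx]
        eqn | assumption)+
qed

theorem theorem1p11:
  fixes U0_1 U0_2 :: "real \<Rightarrow> real"
    and U1 U2 :: "real \<Rightarrow> real \<Rightarrow> real"
    and L1 L2 :: "real \<Rightarrow> real"
  assumes "admissible U0_1" and "admissible U0_2"
    and "classical_solution U0_1 U1 L1"
    and "classical_solution U0_2 U2 L2"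
    and "\<forall>t>0. L1 t = L2 t"
  shows "U0_1 = U0_2"
proof -
  have bound: "\<bar>exp (- t) * (U1 t x - U2 t x)\<bar> \<le> 1" if "t > 0" for t x
  proof -
    have "U1 t x \<in> {0..1}" "U2 t x \<in> {0..1}"
      using assms(3,4) that unfolding classical_solution_def by blast+
    then have "\<bar>U1 t x - U2 t x\<bar> \<le> 1" by auto
    moreover have "exp (- t) \<le> 1" using that by simp
    ultimately show ?thesis
      using mult_mono[of "exp (- t)" 1 "\<bar>U1 t x - U2 t x\<bar>" 1] by (simp add: abs_mult)
  qed
  have flat: "flat_caloric L1 (\<lambda>t x. exp (- t) * (U1 t x - U2 t x))"
    using classical_solution_diff_flat_caloric[OF assms(3,4)] assms(5) by blast
  have "U1 t = U2 t" if "t > 0" for t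
    using flat_caloric_zero[OF flat bound that] by auto
  then have "\<forall>\<^sub>F t in at_right 0. U1 t = U2 t"
    by (auto simp: eventually_at_right_field intro: exI[of _ 1])
  moreover have "L1_loc_tendsto U1 U0_1 (at_right 0)" "L1_loc_tendsto U2 U0_2 (at_right 0)"
    using assms(3,4) unfolding classical_solution_def FBP_def by blast+
  ultimately have "AE x in lborel. U0_1 x = U0_2 x"
    by (intro L1_loc_tendsto_unique_AE) auto
  \<comment> \<open>Right-continuity, contained in the cadlag condition, upgrades equality almost
    everywhere to equality.\<close>
  then show ?thesis
    using assms(1,2) unfolding admissible_def cadlag_def
    by (intro right_continuous_AE_eq) blast+
qed

end
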